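(* Let $n\ge 1$ and let $f$ satisfy (F1)-(F4). Let $u$ be an entire solution of $$\partial_t u-\Delta u=f(u),\qquad 0<u<1\quad\text{in }\mathbb{R}^n\times\mathbb{R},$$ satisfying (H1) $\sup_{x\in\mathbb{R}^n}u(x,t)=1$ for every $t\in\mathbb{R}$; and (H2) $u(x,t)\to0$ uniformly as $\mathrm{dist}\big((x,t),\{u\ge 1-b_0\}\big)\to+\infty$. Then for every $\lambda\in(0,1)$ there is a globally Lipschitz function $h_\lambda:\mathbb{R}^n\to\mathbb{R}$ such that $\{u=\lambda\}=\{(x,t):t=h_\lambda(x)\}$.
   Context: Hypotheses on $f:[0,1]\to\mathbb{R}$: (F1) $f$ is Lipschitz on $[0,1]$, $f(0)=f(1)=0$, and $f\in C^{1,\alpha}([0,\gamma)\cup(1-\gamma,1])$ for some $\alpha,\gamma\in(0,1)$; (F2) $f'(1)<0$; (F3) $\int_0^1 f(u)\,du>0$; (F4) there is $\theta\in(0,1)$ with $f>0$ in $(\theta,1)$ and either $f<0$ in $(0,\theta)$ with $f'(0)<0$ (bistable), or $f\equiv0$ in $(0,\theta)$ (combustion). An entire solution is a smooth solution defined on all of $\mathbb{R}^n\times\mathbb{R}$. $\mathrm{dist}$ is the Euclidean distance in $\mathbb{R}^n\times\mathbb{R}$. The constant $b_0\in(0,1)$ is a fixed constant depending only on $n$ and $f$ such that every entire solution $w$ of $\partial_t w-\Delta w=f(w)$, $0<w<1$, with $\sup_{x}w(x,t)=1$ for all $t$ satisfies: (a) for each $\lambda\in[1-b_0,1)$, $\{w=\lambda\}$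 is the graph $\{t=h_\lambda(x)\}$ of a globally Lipschitz function on $\mathbb{R}^n$; (b) $\partial_t w\ge c_0(1-w)$ and $|\nabla w|+|\partial_t w|\le C_0(1-w)$ in $\{w>1-b_0\}$, with constants $c_0,C_0>0$ depending only on $n$ and $f$. *)

theory Defs
  imports "HOL-Analysis.Analysis"
begin

text \<open>Nonlinearities are total functions on the reals, but only their values on the unit interval
  are ever referred to; in particular the derivatives at 0 and 1 are one-sided.\<close>

definition C1_Holder_on :: "real \<Rightarrow> real set \<Rightarrow> (real \<Rightarrow> real) \<Rightarrow> bool" where
  "C1_Holder_on \<alpha> A f \<longleftrightarrow>
    (\<exists>f' C. (\<forall>s\<in>A. (f has_real_derivative f' s) (at s within A)) \<and>
            (\<forall>r\<in>A. \<forall>s\<in>A. \<bar>f' r - f' s\<bar> \<le> C * \<bar>r - s\<bar> powr \<alpha>))"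

definition F1 :: "(real \<Rightarrow> real) \<Rightarrow> bool" where
  "F1 f \<longleftrightarrow>
    (\<exists>L. L-lipschitz_on {0..1} f) \<and> f 0 = 0 \<and> f 1 = 0 \<and>
    (\<exists>\<alpha>\<in>{0<..<1}. \<exists>\<gamma>\<in>{0<..<1}. C1_Holder_on \<alpha> ({0..<\<gamma>} \<union> {1 - \<gamma><..1}) f)"

definition F2 :: "(real \<Rightarrow> real) \<Rightarrow> bool" where
  "F2 f \<longleftrightarrow> (\<exists>d<0. (f has_real_derivative d) (at 1 within {0..1}))"

definition F3 :: "(real \<Rightarrow> real) \<Rightarrow> bool" where
  "F3 f \<longleftrightarrow> integral {0..1} f > 0"

definition bistable :: "real \<Rightarrow> (real \<Rightarrow> real) \<Rightarrow> bool" where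
  "bistable \<theta> f \<longleftrightarrow>
    (\<forall>s\<in>{0<..<\<theta>}. f s < 0) \<and> (\<exists>d<0. (f has_real_derivative d) (at 0 within {0..1}))"

definition combustion :: "real \<Rightarrow> (real \<Rightarrow> real) \<Rightarrow> bool" where
  "combustion \<theta> f \<longleftrightarrow> (\<forall>s\<in>{0<..<\<theta>}. f s = 0)"

definition F4 :: "(real \<Rightarrow> real) \<Rightarrow> bool" where
  "F4 f \<longleftrightarrow> (\<exists>\<theta>\<in>{0<..<1}. (\<forall>s\<in>{\<theta><..<1}. f s > 0) \<and> (bistable \<theta> f \<or> combustion \<theta> f))"

definition time_partial :: "((real^'n) \<times> real \<Rightarrow> real) \<Rightarrow> (real^'n) \<times> real \<Rightarrow> real" where
  "time_partial u = (\<lambda>(x, t). deriv (\<lambda>s. u (x, s)) t)"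

definition space_partial ::
    "'n::finite \<Rightarrow> ((real^'n) \<times> real \<Rightarrow> real) \<Rightarrow> (real^'n) \<times> real \<Rightarrow> real" where
  "space_partial i u = (\<lambda>(x, t). deriv (\<lambda>s. u (x + s *\<^sub>R axis i 1, t)) 0)"

definition gradient :: "((real^'n::finite) \<times> real \<Rightarrow> real) \<Rightarrow> (real^'n) \<times> real \<Rightarrow> real^'n" where
  "gradient u p = (\<chi> i. space_partial i u p)"

definition laplacian :: "((real^'n::finite) \<times> real \<Rightarrow> real) \<Rightarrow> (real^'n) \<times> real \<Rightarrow> real" where
  "laplacian u p = (\<Sum>i\<in>UNIV. space_partial i (space_partial i u) p)"

definition C1_time :: "((real^'n::finite) \<times> real \<Rightarrow> real) \<Rightarrow> bool" where
  "C1_time u \<longleftrightarrow>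
    (\<forall>x t. (\<lambda>s. u (x, s)) field_differentiable at t) \<and> continuous_on UNIV (time_partial u)"

definition C1_space :: "((real^'n::finite) \<times> real \<Rightarrow> real) \<Rightarrow> bool" where
  "C1_space u \<longleftrightarrow>
    (\<forall>i. (\<forall>x t. (\<lambda>s. u (x + s *\<^sub>R axis i 1, t)) field_differentiable at 0) \<and>
         continuous_on UNIV (space_partial i u))"

text \<open>Since the nonlinearity is merely Lipschitz, solutions are not infinitely differentiable in
  general. A smooth solution is therefore a classical one: once continuously differentiable in
  time and twice in space, with all these derivatives jointly continuous.\<close>

definition entire_solution ::
    "(real \<Rightarrow> real) \<Rightarrow> ((real^'n::finite) \<times> real \<Rightarrow> real) \<Rightarrow> bool" where
  "entire_solution f u \<longleftrightarrow>
    continuous_on UNIV u \<and> C1_time u \<and> C1_space u \<and> (\<forall>i. C1_space (space_partial i u)) \<and>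
    (\<forall>p. time_partial u p - laplacian u p = f (u p))"

definition H1 :: "((real^'n::finite) \<times> real \<Rightarrow> real) \<Rightarrow> bool" where
  "H1 u \<longleftrightarrow> (\<forall>t. (SUP x. u (x, t)) = 1)"

text \<open>\<open>dist\<close> on the product type is the Euclidean distance. Since \<open>infdist\<close> to the empty set is 0,
  \<open>H2\<close> is meaningful only if the superlevel set is nonempty, which \<open>H1\<close> guarantees for
  positive \<open>b\<close>.\<close>

definition H2 :: "real \<Rightarrow> ((real^'n::finite) \<times> real \<Rightarrow> real) \<Rightarrow> bool" where
  "H2 b u \<longleftrightarrow>
    (\<forall>\<epsilon>>0. \<exists>R. \<forall>p. infdist p {q. u q \<ge> 1 - b} \<ge> R \<longrightarrow> \<bar>u p\<bar> < \<epsilon>)"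

definition level_set_Lipschitz_graph :: "((real^'n::finite) \<times> real \<Rightarrow> real) \<Rightarrow> real \<Rightarrow> bool" where
  "level_set_Lipschitz_graph u l \<longleftrightarrow>
    (\<exists>h L. L-lipschitz_on UNIV h \<and> {p. u p = l} = {(x, t). t = h x})"

text \<open>The type argument carries the space dimension: the constants may depend on \<open>f\<close> and on the
  dimension, but not on the solution \<open>w\<close>.\<close>

definition front_constant :: "'n::finite itself \<Rightarrow> (real \<Rightarrow> real) \<Rightarrow> real \<Rightarrow> bool" where
  "front_constant _ f b \<longleftrightarrow>
    0 < b \<and> b < 1 \<and>
    (\<exists>c>0. \<exists>C>0. \<forall>w :: (real^'n) \<times> real \<Rightarrow> real.
      entire_solution f w \<and> (\<forall>p. 0 < w p \<and> w p < 1) \<and> H1 w \<longrightarrow>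
        (\<forall>l\<in>{1 - b..<1}. level_set_Lipschitz_graph w l) \<and>
        (\<forall>p. w p > 1 - b \<longrightarrow>
          time_partial w p \<ge> c * (1 - w p) \<and>
          norm (gradient w p) + \<bar>time_partial w p\<bar> \<le> C * (1 - w p)))"

end

theory Submission
  imports Defs
begin

text \<open>
  The level set of \<open>u\<close> at height \<open>1 - b0\<close> is a Lipschitz graph \<open>t = h x\<close>, the front. It separates
  \<open>u > 1 - b0\<close> (above) from \<open>u < 1 - b0\<close> (below), and \<open>u\<close> tends to 0 uniformly with the depth below
  the front. By the bounds (b) on the derivatives, \<open>u\<close> increases above the front along every
  space-time direction in a sufficiently narrow cone around the time axis
  (\<open>cone_monotone_above\<close>). The theorem amounts to extending this monotonicity below the front: if
  \<open>u\<close> increases strictly along all directions of a cone, its level sets are Lipschitz graphs.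
  
  The extension is the sliding method. Fix a direction \<open>e\<close> in the cone and compare \<open>u\<close> with its
  translate $u(\cdot + \tau e)$. Where \<open>u\<close> is small, \<open>f\<close> is nonincreasing (in the bistable case because
  $f'(0) < 0$, in the combustion case because \<open>f\<close> vanishes there), so the maximum principle
  transfers the order of the two functions from the region where \<open>u\<close> is not small
  (\<open>ordered_of_middle\<close>). What remains is the strip \<open>\<delta> \<le> u < 1 - b0\<close>, which has bounded depth below
  the front. For large \<open>\<tau>\<close> the translate exceeds \<open>1 - b0\<close> on it. If the order holds for some
  \<open>\<tau> > 0\<close>, then it holds on the strip with a uniform gap (\<open>increase_bounded_below\<close>) and hence
  persists for slightly smaller \<open>\<tau>\<close>; so \<open>\<tau>\<close> can be lowered to 0. The same gap gives strict
  monotonicity.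
  
  The uniform gap is usually obtained by passing to limits of translates and applying the strong
  maximum principle. Here compactness is replaced by explicit estimates, each of them an
  application of the minimum principle on a compact set (\<open>heat_minimum_principle\<close>) to an explicit
  barrier: a global modulus of continuity of \<open>u\<close>, whose spatial part comes from comparing \<open>u\<close> with
  its reflection across a hyperplane (\<open>reflection_barrier\<close>), and a propagation of positivity along
  lines with explicit loss (\<open>positivity_propagates\<close>). If the gap were tiny at some point, then by
  propagation \<open>u\<close> would hardly change over many backward steps of length \<open>\<tau>\<close>, although it must
  become small within a bounded number of them.
\<close>

section \<open>The heat operator at a point\<close>

text \<open>
  \<open>heat_op_at w p g\<close> says that all derivatives entering $w_t - \Delta w$ exist at \<open>p\<close> and that this
  expression equals \<open>g\<close>; the first space derivatives are required along the whole coordinate lines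
  through \<open>p\<close>, so that differentiating them again makes sense. As a relation it passes through sums, multiples, translations and
  reflections without separate differentiability side conditions.
\<close>

definition heat_op_at :: "((real^'n::finite) \<times> real \<Rightarrow> real) \<Rightarrow> (real^'n) \<times> real \<Rightarrow> real \<Rightarrow> bool" where
  "heat_op_at w p g \<longleftrightarrow>
    (\<exists>D d e. ((\<lambda>s. w (fst p, s)) has_real_derivative D) (at (snd p)) \<and>
      (\<forall>i s. ((\<lambda>s. w (fst p + s *\<^sub>R axis i 1, snd p)) has_real_derivative d i s) (at s)) \<and>
      (\<forall>i. (d i has_real_derivative e i) (at 0)) \<and> g = D - (\<Sum>i\<in>UNIV. e i))"

lemma heat_op_atI:
  assumes "((\<lambda>s. w (x, s)) has_real_derivative D) (at t)"
    and "\<And>i s. ((\<lambda>s. w (x + s *\<^sub>R axis i 1, t)) has_real_derivative d i s) (at s)"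
    and "\<And>i. (d i has_real_derivative e i) (at 0)"
    and "g = D - (\<Sum>i\<in>UNIV. e i)"
  shows "heat_op_at w (x, t) g"
  unfolding heat_op_at_def fst_conv snd_conv using assms by blast

lemma heat_op_atE:
  assumes "heat_op_at w (x, t) g"
  obtains D d e where "((\<lambda>s. w (x, s)) has_real_derivative D) (at t)"
    and "\<And>i s. ((\<lambda>s. w (x + s *\<^sub>R axis i 1, t)) has_real_derivative d i s) (at s)"
    and "\<And>i. (d i has_real_derivative e i) (at 0)"
    and "g = D - (\<Sum>i\<in>UNIV. e i)"
  using assms unfolding heat_op_at_def fst_conv snd_conv by blast

lemma heat_op_at_add:
  assumes "heat_op_at v p a" and "heat_op_at w p b"
  shows "heat_op_at (\<lambda>q. v q + w q) p (a + b)"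
proof (cases p)
  case (Pair x t)
  from assms(1)[unfolded Pair] obtain D d e where 1: "((\<lambda>s. v (x, s)) has_real_derivative D) (at t)"
    "\<And>i s. ((\<lambda>s. v (x + s *\<^sub>R axis i 1, t)) has_real_derivative d i s) (at s)"
    "\<And>i. (d i has_real_derivative e i) (at 0)" "a = D - (\<Sum>i\<in>UNIV. e i)"
    by (erule heat_op_atE)
  from assms(2)[unfolded Pair] obtain D' d' e' where 2: "((\<lambda>s. w (x, s)) has_real_derivative D') (at t)"
    "\<And>i s. ((\<lambda>s. w (x + s *\<^sub>R axis i 1, t)) has_real_derivative d' i s) (at s)"
    "\<And>i. (d' i has_real_derivative e' i) (at 0)" "b = D' - (\<Sum>i\<in>UNIV. e' i)"
    by (erule heat_op_atE)
  show ?thesis unfolding Pair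
    by (rule heat_op_atI[OF DERIV_add[OF 1(1) 2(1)] DERIV_add[OF 1(2) 2(2)] DERIV_add[OF 1(3) 2(3)]])
      (simp add: 1(4) 2(4) sum.distrib)
qed

lemma heat_op_at_scale:
  assumes "heat_op_at w p b"
  shows "heat_op_at (\<lambda>q. k * w q) p (k * b)"
proof (cases p)
  case (Pair x t)
  from assms(1)[unfolded Pair] obtain D' d' e' where 2: "((\<lambda>s. w (x, s)) has_real_derivative D') (at t)"
    "\<And>i s. ((\<lambda>s. w (x + s *\<^sub>R axis i 1, t)) has_real_derivative d' i s) (at s)"
    "\<And>i. (d' i has_real_derivative e' i) (at 0)" "b = D' - (\<Sum>i\<in>UNIV. e' i)"
    by (erule heat_op_atE)
  show ?thesis unfolding Pair
    by (rule heat_op_atI[OF DERIV_cmult[OF 2(1)] DERIV_cmult[OF 2(2)] DERIV_cmult[OF 2(3)]])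
      (simp add: 2(4) sum_distrib_left right_diff_distrib)
qed

lemma heat_op_at_diff:
  assumes "heat_op_at v p a" and "heat_op_at w p b"
  shows "heat_op_at (\<lambda>q. v q - w q) p (a - b)"
  using heat_op_at_add[OF assms(1) heat_op_at_scale[OF assms(2), of "-1"]] by simp

lemma heat_op_at_translate:
  assumes "heat_op_at w (p + a) g"
  shows "heat_op_at (\<lambda>q. w (q + a)) p g"
proof (cases p)
  case (Pair x t)
  obtain y r where a: "a = (y, r)" by (cases a)
  from assms[unfolded Pair a, simplified] obtain D d e where
    1: "((\<lambda>s. w (x + y, s)) has_real_derivative D) (at (t + r))"
    "\<And>i s. ((\<lambda>s. w (x + y + s *\<^sub>R axis i 1, t + r)) has_real_derivative d i s) (at s)"
    "\<And>i. (d i has_real_derivative e i) (at 0)" "g = D - (\<Sum>i\<in>UNIV. e i)"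
    by (erule heat_op_atE)
  show ?thesis unfolding Pair
  proof (rule heat_op_atI[OF _ _ 1(3,4)])
    show "((\<lambda>s. w ((x, s) + a)) has_real_derivative D) (at t)"
      using 1(1) by (simp add: a DERIV_shift)
    show "((\<lambda>s. w ((x + s *\<^sub>R axis i 1, t) + a)) has_real_derivative d i s) (at s)" for i s
      using 1(2)[of i s] by (simp add: a add_ac)
  qed
qed

text \<open>
  The spatial reflection across the hyperplane $x_i = c$.
\<close>

definition reflect :: "'n::finite \<Rightarrow> real \<Rightarrow> (real^'n) \<times> real \<Rightarrow> (real^'n) \<times> real" where
  "reflect i c p = (fst p + (2 * (c - fst p $ i)) *\<^sub>R axis i 1, snd p)"

lemma heat_op_at_reflect:
  assumes "heat_op_at w (reflect i c p) g"
  shows "heat_op_at (\<lambda>q. w (reflect i c q)) p g"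
proof (cases p)
  case (Pair x t)
  define y where "y = x + (2 * (c - x $ i)) *\<^sub>R axis i 1"
  from assms obtain D d e where
    1: "((\<lambda>s. w (y, s)) has_real_derivative D) (at t)"
    "\<And>i s. ((\<lambda>s. w (y + s *\<^sub>R axis i 1, t)) has_real_derivative d i s) (at s)"
    "\<And>i. (d i has_real_derivative e i) (at 0)" "g = D - (\<Sum>i\<in>UNIV. e i)"
    unfolding Pair reflect_def fst_conv snd_conv y_def[symmetric] by (erule heat_op_atE)
  define \<sigma> where "\<sigma> j = (if j = i then -1 else 1 :: real)" for j
  show ?thesis unfolding Pair
  proof (rule heat_op_atI[OF _ _ _ 1(4)])
    show "((\<lambda>s. w (reflect i c (x, s))) has_real_derivative D) (at t)"
      using 1(1) by (simp add: reflect_def y_def)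
    have eq: "reflect i c (x + s *\<^sub>R axis j 1, t) = (y + (\<sigma> j * s) *\<^sub>R axis j 1, t)" for j s
      by (auto simp: reflect_def y_def \<sigma>_def vec_eq_iff axis_def algebra_simps)
    show "((\<lambda>s. w (reflect i c (x + s *\<^sub>R axis j 1, t))) has_real_derivative \<sigma> j * d j (\<sigma> j * s)) (at s)" for j s
    proof -
      have "((\<lambda>s. \<sigma> j * s) has_real_derivative \<sigma> j) (at s)"
        by (auto intro!: derivative_eq_intros)
      from DERIV_chain2[where f = "\<lambda>s. w (y + s *\<^sub>R axis j 1, t)", OF 1(2) this]
      show ?thesis unfolding eq by (simp add: mult.commute)
    qed
    have "((\<lambda>s. \<sigma> j * d j (\<sigma> j * s)) has_real_derivative \<sigma> j * (e j * \<sigma> j)) (at 0)" for j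
      by (rule DERIV_cmult, rule DERIV_chain2[where f = "d j"])
        (use 1(3)[of j] in \<open>auto intro!: derivative_eq_intros\<close>)
    moreover have "\<sigma> j * (e j * \<sigma> j) = e j" for j by (simp add: \<sigma>_def)
    ultimately show "((\<lambda>s. \<sigma> j * d j (\<sigma> j * s)) has_real_derivative e j) (at 0)" for j
      by simp
  qed
qed

lemma heat_op_at_time:
  assumes "(k has_real_derivative D) (at (snd p))"
  shows "heat_op_at (\<lambda>q. k (snd q)) p D"
proof -
  have "heat_op_at (\<lambda>q. k (snd q)) (fst p, snd p) D"
    by (rule heat_op_atI[where D = D and d = "\<lambda>_ _. 0" and e = "\<lambda>_. 0"]) (use assms in auto)
  then show ?thesis by simp
qed

lemma heat_op_at_const: "heat_op_at (\<lambda>q. k) p 0"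
  by (rule heat_op_at_time[where k = "\<lambda>_. k"]) simp

lemma heat_op_at_affine_time: "heat_op_at (\<lambda>q. snd q - r) p 1"
  by (rule heat_op_at_time[where k = "\<lambda>t. t - r"]) (auto intro!: derivative_eq_intros)

lemma inner_axis_shift:
  fixes a :: "real^'n::finite"
  shows "(a + s *\<^sub>R axis i 1) \<bullet> (a + s *\<^sub>R axis i 1) = a \<bullet> a + 2 * s * (a $ i) + s^2"
  by (simp add: inner_add_left inner_add_right inner_axis inner_commute[of "axis i 1"] power2_eq_square algebra_simps)

lemma heat_op_at_dist_sq:
  fixes x0 :: "real^'n::finite"
  shows "heat_op_at (\<lambda>q. (fst q - x0) \<bullet> (fst q - x0)) p (- 2 * real CARD('n))"
proof (cases p)
  case (Pair x t)
  have eq: "x + s *\<^sub>R axis i 1 - x0 = (x - x0) + s *\<^sub>R axis i 1" for s :: real and i by simp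
  show ?thesis unfolding Pair
    by (rule heat_op_atI[where D = 0 and d = "\<lambda>i s. 2 * ((x - x0) $ i) + 2 * s" and e = "\<lambda>i. 2"])
      (auto simp: eq inner_axis_shift simp del: vector_minus_component intro!: derivative_eq_intros)
qed

text \<open>
  The profile $s(2-s)$ vanishes on the hyperplane $s = 0$ and is strictly concave; it carries the
  boundary behaviour of the gradient barrier.
\<close>

lemma heat_op_at_parabola:
  fixes i :: "'n::finite"
  shows "heat_op_at (\<lambda>q. (fst q $ i - c) * (2 - (fst q $ i - c))) p 2"
proof (cases p)
  case (Pair x t)
  define \<delta> where "\<delta> j = (if j = i then 1 else 0 :: real)" for j
  have eq: "(axis j 1 :: real^'n) $ i = \<delta> j" for j
    by (simp add: axis_def \<delta>_def)
  have "(\<Sum>j\<in>UNIV. - 2 * (\<delta> j * \<delta> j)) = -2"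
    by (simp add: \<delta>_def if_distrib[of "\<lambda>z. z * _"] sum_negf cong: if_cong flip: sum_distrib_left)
  then show ?thesis unfolding Pair
    by (intro heat_op_atI[where D = 0 and d = "\<lambda>j s. 2 * \<delta> j - 2 * \<delta> j * (x $ i - c + s * \<delta> j)" and e = "\<lambda>j. - 2 * (\<delta> j * \<delta> j)"])
      (auto simp: eq algebra_simps intro!: derivative_eq_intros)
qed

text \<open>
  The bump $e^{-A(t-t_1)}\,(r^2 - |x - x_1 - (t-t_1)\xi|^2)^2$ lives on a ball that moves with velocity
  \<open>\<xi>\<close>. The square makes its gradient vanish on the boundary of the ball, so that there the
  second derivatives dominate.
\<close>

lemma heat_op_at_moving_bump:
  fixes x1 \<xi> :: "real^'n::finite"
  assumes "y = x - x1 - (t - t1) *\<^sub>R \<xi>" and "q = r^2 - y \<bullet> y"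
  shows "heat_op_at (\<lambda>p. exp (- A * (snd p - t1)) *
      (r^2 - (fst p - x1 - (snd p - t1) *\<^sub>R \<xi>) \<bullet> (fst p - x1 - (snd p - t1) *\<^sub>R \<xi>))^2) (x, t)
    (exp (- A * (t - t1)) * (4 * q * (y \<bullet> \<xi>) - A * q^2 - 8 * (y \<bullet> y) + 4 * real CARD('n) * q))"
proof -
  have eqt: "(x - x1 - (s - t1) *\<^sub>R \<xi>) \<bullet> (x - x1 - (s - t1) *\<^sub>R \<xi>)
      = (x - x1) \<bullet> (x - x1) - 2 * (s - t1) * ((x - x1) \<bullet> \<xi>) + (s - t1)^2 * (\<xi> \<bullet> \<xi>)" for s
    by (simp add: inner_diff_left inner_diff_right inner_commute power2_eq_square algebra_simps)
  have yx: "y \<bullet> \<xi> = (x - x1) \<bullet> \<xi> - (t - t1) * (\<xi> \<bullet> \<xi>)"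
    by (simp add: assms(1) inner_diff_left)
  have q: "q = r^2 - ((x - x1) \<bullet> (x - x1) - 2 * (t - t1) * ((x - x1) \<bullet> \<xi>) + (t - t1)^2 * (\<xi> \<bullet> \<xi>))"
    by (simp only: assms eqt)
  have eqs: "x + s *\<^sub>R axis i 1 - x1 - (t - t1) *\<^sub>R \<xi> = y + s *\<^sub>R axis i 1" for s :: real and i
    by (simp add: assms(1) algebra_simps)
  let ?E = "exp (- A * (t - t1))"
  have sum: "(\<Sum>i\<in>UNIV. ?E * (8 * (y $ i)^2 - 4 * q)) = ?E * (8 * (y \<bullet> y) - 4 * real CARD('n) * q)"
    by (simp add: sum_subtractf inner_vec_def power2_eq_square flip: sum_distrib_left)
  show ?thesis
  proof (rule heat_op_atI[where D = "?E * (4 * q * (y \<bullet> \<xi>) - A * q^2)"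
        and d = "\<lambda>i s. ?E * (2 * (r^2 - (y \<bullet> y + 2 * s * (y $ i) + s^2)) * (- 2 * (y $ i) - 2 * s))"
        and e = "\<lambda>i. ?E * (8 * (y $ i)^2 - 4 * q)"], goal_cases)
    case 1
    have "((\<lambda>s. r^2 - ((x - x1) \<bullet> (x - x1) - 2 * (s - t1) * ((x - x1) \<bullet> \<xi>) + (s - t1)^2 * (\<xi> \<bullet> \<xi>)))
        has_real_derivative 2 * (y \<bullet> \<xi>)) (at t)"
      unfolding yx by (auto intro!: derivative_eq_intros simp: algebra_simps)
    from DERIV_power[OF this, of 2]
    have 1: "((\<lambda>s. (r^2 - ((x - x1) \<bullet> (x - x1) - 2 * (s - t1) * ((x - x1) \<bullet> \<xi>) + (s - t1)^2 * (\<xi> \<bullet> \<xi>)))^2)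
        has_real_derivative 4 * q * (y \<bullet> \<xi>)) (at t)"
      unfolding q[symmetric] by (simp add: mult_ac)
    have 2: "((\<lambda>s. exp (- A * (s - t1))) has_real_derivative - A * ?E) (at t)"
      by (auto intro!: derivative_eq_intros)
    have eq: "?E * (4 * q * (y \<bullet> \<xi>) - A * q^2) = - A * ?E * q^2 + 4 * q * (y \<bullet> \<xi>) * ?E"
      by (simp add: algebra_simps)
    show ?case unfolding fst_conv snd_conv eqt eq
      using DERIV_mult[OF 2 1] unfolding q[symmetric] .
  next
    case (2 i s)
    have "((\<lambda>s. r^2 - (y \<bullet> y + 2 * s * (y $ i) + s^2)) has_real_derivative - 2 * (y $ i) - 2 * s) (at s)"
      by (auto intro!: derivative_eq_intros)
    from DERIV_cmult[OF DERIV_power[OF this, of 2], of ?E]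
    show ?case unfolding fst_conv snd_conv eqs inner_axis_shift
      by (rule DERIV_cong) (simp add: mult_ac)
  next
    case (3 i)
    have 1: "((\<lambda>s. 2 * (r^2 - (y \<bullet> y + 2 * s * (y $ i) + s^2))) has_real_derivative 2 * (- 2 * (y $ i))) (at 0)"
      by (auto intro!: derivative_eq_intros)
    have 2: "((\<lambda>s. - 2 * (y $ i) - 2 * s) has_real_derivative - 2) (at 0)"
      by (auto intro!: derivative_eq_intros)
    from DERIV_cmult[OF DERIV_mult[OF 1 2], of ?E]
    show ?case by (simp add: assms(2) power2_eq_square algebra_simps)
  next
    case 4
    show ?case unfolding sum by (simp add: algebra_simps)
  qed
qed

section \<open>The minimum principle\<close>

lemma second_derivative_nonneg_at_min:
  fixes f :: "real \<Rightarrow> real"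
  assumes "\<And>s. (f has_real_derivative d s) (at s)" and "(d has_real_derivative e) (at 0)"
    and "0 < \<epsilon>" and min: "\<And>s. \<bar>s\<bar> < \<epsilon> \<Longrightarrow> f 0 \<le> f s"
  shows "e \<ge> 0"
proof (rule ccontr)
  assume "\<not> e \<ge> 0"
  have d0: "d 0 = 0"
    using DERIV_local_min[OF assms(1)[of 0] \<open>0 < \<epsilon>\<close>] min by simp
  obtain \<delta> where \<delta>: "\<delta> > 0" "\<And>h. 0 < h \<Longrightarrow> h < \<delta> \<Longrightarrow> d h < 0"
    using DERIV_neg_dec_right[OF assms(2)] \<open>\<not> e \<ge> 0\<close> d0 by force
  define h where "h = min \<epsilon> \<delta> / 2"
  have h: "0 < h" "h < \<epsilon>" "h < \<delta>" using \<delta>(1) \<open>0 < \<epsilon>\<close> by (auto simp: h_def)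
  obtain z where "0 < z" "z < h" "f h - f 0 = (h - 0) * d z"
    using MVT2[of 0 h f d] h(1) assms(1) by blast
  with \<delta>(2)[of z] h have "f h < f 0"
    by (metis diff_0_right diff_less_0_iff_less mult_pos_neg order.strict_trans)
  with min[of h] h show False by simp
qed

text \<open>
  At a negative minimum off the parabolic boundary the time derivative is nonpositive (only earlier
  times are compared, so the top time is allowed) and all pure second derivatives are nonnegative;
  the heat operator would be nonpositive there. Strict positivity is demanded only where \<open>w\<close> is
  negative: in the applications \<open>w\<close> combines a solution with a barrier, and the sign of the
  reaction term is known only at such points. The set where \<open>\<Phi>\<close> is nonpositive may move with time.
\<close>

lemma heat_minimum_principle:
  fixes w \<Phi> :: "(real^'n::finite) \<times> real \<Rightarrow> real"
  assumes bounded: "bounded {p. t1 \<le> snd p \<and> snd p \<le> t0 \<and> \<Phi> p \<le> 0}"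
    and cont: "continuous_on UNIV \<Phi>" "continuous_on UNIV w"
    and boundary: "\<And>x t. t1 \<le> t \<Longrightarrow> t \<le> t0 \<Longrightarrow> \<Phi> (x, t) \<le> 0 \<Longrightarrow> t = t1 \<or> \<Phi> (x, t) = 0 \<Longrightarrow> 0 \<le> w (x, t)"
    and interior: "\<And>x t. t1 < t \<Longrightarrow> t \<le> t0 \<Longrightarrow> \<Phi> (x, t) < 0 \<Longrightarrow> w (x, t) < 0 \<Longrightarrow>
      \<exists>g>0. heat_op_at w (x, t) g"
    and p: "t1 \<le> t" "t \<le> t0" "\<Phi> (x, t) \<le> 0"
  shows "0 \<le> w (x, t)"
proof -
  define K where "K = {p. t1 \<le> snd p \<and> snd p \<le> t0 \<and> \<Phi> p \<le> 0}"
  have "closed K"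
    unfolding K_def by (intro closed_Collect_conj closed_Collect_le continuous_intros cont)
  then have "compact K" using bounded by (simp add: compact_eq_bounded_closed K_def)
  moreover have xK: "(x, t) \<in> K" using p by (simp add: K_def)
  ultimately obtain m where m: "m \<in> K" "\<And>q. q \<in> K \<Longrightarrow> w m \<le> w q"
    using continuous_attains_inf[of K w] continuous_on_subset[OF cont(2)] by blast
  obtain y s where ys: "m = (y, s)" by (cases m)
  have "0 \<le> w m"
  proof (rule ccontr)
    assume neg: "\<not> 0 \<le> w m"
    have s: "t1 < s" "s \<le> t0" "\<Phi> m < 0"
      using m(1) neg boundary[of s y] unfolding K_def ys by force+
    obtain g where g: "g > 0" "heat_op_at w m g"
      using interior[of s y] s neg unfolding ys by auto
    from g(2)[unfolded ys] obtain D d e where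
      1: "((\<lambda>s. w (y, s)) has_real_derivative D) (at s)"
      "\<And>i r. ((\<lambda>r. w (y + r *\<^sub>R axis i 1, s)) has_real_derivative d i r) (at r)"
      "\<And>i. (d i has_real_derivative e i) (at 0)" "g = D - (\<Sum>i\<in>UNIV. e i)"
      by (erule heat_op_atE)
    have "open {p. \<Phi> p < 0}" by (intro open_Collect_less continuous_intros cont)
    then obtain \<epsilon> where \<epsilon>: "\<epsilon> > 0" "\<And>q. dist q m < \<epsilon> \<Longrightarrow> \<Phi> q < 0"
      using s(3) unfolding open_dist by (metis mem_Collect_eq)
    have "D \<le> 0"
    proof (rule ccontr)
      assume "\<not> D \<le> 0"
      then obtain \<delta> where \<delta>: "\<delta> > 0" "\<And>h. 0 < h \<Longrightarrow> h < \<delta> \<Longrightarrow> w (y, s - h) < w (y, s)"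
        using DERIV_pos_inc_left[OF 1(1)] by force
      define h where "h = min (min \<epsilon> \<delta>) (s - t1) / 2"
      have h: "0 < h" "h < \<epsilon>" "h < \<delta>" "h < s - t1"
        using \<delta>(1) \<epsilon>(1) s(1) by (auto simp: h_def min_def)
      have "dist (y, s - h) m < \<epsilon>" using h by (simp add: ys dist_Pair_Pair dist_real_def)
      then have "(y, s - h) \<in> K" using \<epsilon>(2) h s by (auto simp: K_def intro: less_imp_le)
      from m(2)[OF this] \<delta>(2)[of h] h show False by (simp add: ys)
    qed
    moreover have "e i \<ge> 0" for i
    proof (rule second_derivative_nonneg_at_min[OF 1(2)[of i] 1(3)[of i] \<epsilon>(1)])
      fix r :: real assume r: "\<bar>r\<bar> < \<epsilon>"
      have "dist (y + r *\<^sub>R axis i 1, s) m < \<epsilon>" using r by (simp add: ys dist_Pair_Pair dist_norm)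
      then have "(y + r *\<^sub>R axis i 1, s) \<in> K" using \<epsilon>(2) s by (auto simp: K_def intro: less_imp_le)
      from m(2)[OF this] show "w (y + 0 *\<^sub>R axis i 1, s) \<le> w (y + r *\<^sub>R axis i 1, s)"
        by (simp add: ys)
    qed
    ultimately have "g \<le> 0" using 1(4) by (simp add: sum_nonneg le_diff_eq order_trans)
    with g(1) show False by simp
  qed
  then show ?thesis using m(2)[OF xK] by linarith
qed

lemma bounded_cylinder:
  fixes x0 :: "'a::real_inner"
  shows "bounded {p :: 'a \<times> real. t1 \<le> snd p \<and> snd p \<le> t0 \<and> (fst p - x0) \<bullet> (fst p - x0) - r^2 \<le> 0}"
proof (rule bounded_subset[OF bounded_Times])
  show "bounded (cball x0 \<bar>r\<bar>)" "bounded {t1..t0}" by auto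
  show "{p. t1 \<le> snd p \<and> snd p \<le> t0 \<and> (fst p - x0) \<bullet> (fst p - x0) - r^2 \<le> 0} \<subseteq> cball x0 \<bar>r\<bar> \<times> {t1..t0}"
    by (auto simp: dist_norm norm_minus_commute norm_le_square power2_eq_square)
qed

section \<open>A modulus of continuity for bounded solutions\<close>

text \<open>
  The odd difference $w - w \circ R$ vanishes on the mirror hyperplane and is at most 1. On the half
  ball of radius 1 around \<open>y\<close>, over a unit time interval, the barrier
  $|x-y|^2 + (t - s) + k\,(x_i-c)(2-(x_i-c))$ is at least 1 on the remaining boundary, and the
  concave last term makes it a strict supersolution against the right-hand side. At \<open>y\<close> only the
  last term survives, and it is linear in the distance to the mirror. No derivative of the
  right-hand side enters, so a merely bounded one suffices.
\<close>

lemma reflection_barrier: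
  fixes w g :: "(real^'n::finite) \<times> real \<Rightarrow> real" and y :: "real^'n"
  assumes heat: "\<And>p. heat_op_at w p (g p)" and cont: "continuous_on UNIV w"
    and g: "\<And>p. \<bar>g p\<bar> \<le> M" and w: "\<And>p. 0 \<le> w p \<and> w p \<le> 1"
    and y: "c \<le> y $ i" "y $ i \<le> c + 1"
  shows "w (y, t) - w (reflect i c (y, t)) \<le> 2 * (real CARD('n) + M + 1) * (y $ i - c)"
proof -
  let ?N = "real CARD('n)"
  define k where "k = ?N + M + 1"
  have "M \<ge> 0" using g[of "(y, t)"] by linarith
  then have k1: "k \<ge> 1" by (simp add: k_def)
  define \<psi> where "\<psi> p = (fst p $ i - c) * (2 - (fst p $ i - c))" for p :: "(real^'n) \<times> real"
  define v where "v p = ((fst p - y) \<bullet> (fst p - y) - (snd p - t)) + k * \<psi> p - (w p - w (reflect i c p))" for p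
  define \<Phi> where "\<Phi> p = max ((fst p - y) \<bullet> (fst p - y) - 1^2) (c - fst p $ i)" for p :: "(real^'n) \<times> real"
  have "0 \<le> v (y, t)"
  proof (rule heat_minimum_principle[where ?t1.0 = "t - 1" and ?t0.0 = t and \<Phi> = \<Phi>])
    show "bounded {p. t - 1 \<le> snd p \<and> snd p \<le> t \<and> \<Phi> p \<le> 0}"
      by (rule bounded_subset[OF bounded_cylinder[of "t - 1" t y 1]]) (auto simp: \<Phi>_def)
    show "continuous_on UNIV \<Phi>" unfolding \<Phi>_def by (intro continuous_intros)
    have "continuous_on UNIV (\<lambda>p. w (reflect i c p))"
      unfolding reflect_def by (intro continuous_on_compose2[OF cont] continuous_intros) auto
    then show "continuous_on UNIV v" unfolding v_def \<psi>_def
      by (intro continuous_intros cont) 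
  next
    fix x s assume s: "t - 1 \<le> s" "s \<le> t" "\<Phi> (x, s) \<le> 0" "s = t - 1 \<or> \<Phi> (x, s) = 0"
    define n where "n = (x - y) \<bullet> (x - y)"
    have n: "0 \<le> n" "n \<le> 1" "c \<le> x $ i" using s(3) by (auto simp: n_def \<Phi>_def)
    have "\<bar>(x - y) $ i\<bar> \<le> norm (x - y)" by (rule component_le_norm_cart)
    also have "\<dots> \<le> 1" using n(2) by (simp add: n_def norm_le_square)
    finally have xi: "0 \<le> x $ i - c" "x $ i - c \<le> 2" using y n by auto
    then have \<psi>: "0 \<le> k * \<psi> (x, s)" using k1 by (auto simp: \<psi>_def intro!: mult_nonneg_nonneg)
    have w1: "w (x, s) - w (reflect i c (x, s)) \<le> 1" using w[of "(x, s)"] w[of "reflect i c (x, s)"] by linarith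
    consider "s = t - 1" | "n = 1" | "c = x $ i" using s(4) n unfolding \<Phi>_def fst_conv n_def[symmetric] by fastforce
    then show "0 \<le> v (x, s)"
    proof cases
      case 3
      then have "reflect i c (x, s) = (x, s)" by (simp add: reflect_def)
      then show ?thesis using \<psi> n(1) s(2) by (simp add: v_def n_def[symmetric])
    qed (use n w1 \<psi> s in \<open>auto simp: v_def n_def[symmetric]\<close>)
  next
    fix x s
    have "heat_op_at v (x, s) ((- 2 * ?N - 1) + k * 2 - (g (x, s) - g (reflect i c (x, s))))"
      unfolding v_def \<psi>_def
      by (intro heat_op_at_add heat_op_at_diff heat_op_at_scale heat_op_at_dist_sq
          heat_op_at_affine_time heat_op_at_parabola heat_op_at_reflect heat)
    moreover have "(- 2 * ?N - 1) + k * 2 - (g (x, s) - g (reflect i c (x, s))) > 0"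
      using g[of "(x, s)"] g[of "reflect i c (x, s)"] by (simp add: k_def)
    ultimately show "\<exists>g>0. heat_op_at v (x, s) g" by blast
  qed (use y in \<open>auto simp: \<Phi>_def\<close>)
  then have "w (y, t) - w (reflect i c (y, t)) \<le> k * ((y $ i - c) * (2 - (y $ i - c)))"
    by (simp add: v_def \<psi>_def)
  also have "\<dots> \<le> k * ((y $ i - c) * 2)"
    using k1 y by (intro mult_left_mono) auto
  also have "\<dots> = 2 * k * (y $ i - c)" by simp
  finally show ?thesis by (simp only: k_def)
qed

text \<open>
  Two points on a coordinate line are mirror images of each other across the hyperplane halfway
  between them.
\<close>

lemma heat_directional_lipschitz:
  fixes w g :: "(real^'n::finite) \<times> real \<Rightarrow> real"
  assumes heat: "\<And>p. heat_op_at w p (g p)" and cont: "continuous_on UNIV w"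
    and g: "\<And>p. \<bar>g p\<bar> \<le> M" and w: "\<And>p. 0 \<le> w p \<and> w p \<le> 1"
  shows "w (x + h *\<^sub>R axis i 1, t) - w (x, t) \<le> (real CARD('n) + M + 1) * \<bar>h\<bar>"
proof -
  have "M \<ge> 0" using g[of "(x, t)"] by linarith
  consider "\<bar>h\<bar> \<ge> 1" | "0 \<le> h" "h \<le> 1" | "h \<le> 0" "- h \<le> 1" by linarith
  then show ?thesis
  proof cases
    case 1
    have "1 * 1 \<le> (real CARD('n) + M + 1) * \<bar>h\<bar>" using 1 \<open>M \<ge> 0\<close> by (intro mult_mono) auto
    then show ?thesis using w[of "(x + h *\<^sub>R axis i 1, t)"] w[of "(x, t)"] by linarith
  next
    case 2
    define c where "c = x $ i + h / 2"
    have "reflect i c (x + h *\<^sub>R axis i 1, t) = (x, t)"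
      by (auto simp: reflect_def c_def vec_eq_iff axis_def algebra_simps)
    then show ?thesis
      using reflection_barrier[OF heat cont g w, of c "x + h *\<^sub>R axis i 1" i t] 2
      by (simp add: c_def algebra_simps)
  next
    case 3
    define c where "c = x $ i + h / 2"
    \<comment> \<open>The point with the larger coordinate is now x, so the barrier is used for 1 - w.\<close>
    have r: "reflect i c (x, t) = (x + h *\<^sub>R axis i 1, t)"
      by (auto simp: reflect_def c_def vec_eq_iff axis_def algebra_simps)
    have "(1 - w (x, t)) - (1 - w (reflect i c (x, t))) \<le> 2 * (real CARD('n) + M + 1) * (x $ i - c)"
    proof (rule reflection_barrier)
      show "heat_op_at (\<lambda>p. 1 - w p) p (0 - g p)" for p
        by (rule heat_op_at_diff[OF heat_op_at_const heat])
      show "continuous_on UNIV (\<lambda>p. 1 - w p)" by (intro continuous_intros cont)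
    qed (use g w 3 in \<open>auto simp: c_def\<close>)
    then show ?thesis unfolding r using 3 by (simp add: c_def algebra_simps)
  qed
qed

text \<open>
  The increment \<open>\<xi>\<close> is made one coordinate at a time. The steps are required only inside the ball
  of radius $n|\xi|$, which contains the whole staircase; this locality matters for functions that
  are controlled only on one side of a front.
\<close>

lemma lipschitz_of_coordinate_steps:
  fixes F :: "real^'n::finite \<Rightarrow> real" and \<xi> :: "real^'n"
  assumes C: "0 \<le> C"
    and step: "\<And>y i. norm (y - x) \<le> real CARD('n) * norm \<xi> \<Longrightarrow>
      norm (y + (\<xi> $ i) *\<^sub>R axis i 1 - x) \<le> real CARD('n) * norm \<xi> \<Longrightarrow>
      F (y + (\<xi> $ i) *\<^sub>R axis i 1) - F y \<le> C * \<bar>\<xi> $ i\<bar>"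
  shows "F (x + \<xi>) - F x \<le> C * real CARD('n) * norm \<xi>"
proof -
  define y where "y S = x + (\<Sum>i\<in>S. (\<xi> $ i) *\<^sub>R axis i 1)" for S :: "'n set"
  have yx: "norm (y S - x) \<le> real CARD('n) * norm \<xi>" for S
  proof -
    have "norm (y S - x) \<le> (\<Sum>i\<in>S. norm \<xi>)"
      unfolding y_def add_diff_cancel_left'
      by (rule sum_norm_le) (simp add: component_le_norm_cart)
    also have "\<dots> \<le> real CARD('n) * norm \<xi>" 
      by (auto intro!: mult_right_mono card_mono)
    finally show ?thesis .
  qed
  have "F (y S) - F x \<le> C * real (card S) * norm \<xi>" for S
  proof (induction S rule: finite_induct[OF finite])
    case 1 then show ?case by (simp add: y_def)
  next
    case (2 i S)
    have eq: "y (insert i S) = y S + (\<xi> $ i) *\<^sub>R axis i 1"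
      using 2 by (simp add: y_def add_ac)
    have "F (y (insert i S)) - F (y S) \<le> C * \<bar>\<xi> $ i\<bar>"
      unfolding eq by (rule step[OF yx]) (use yx[of "insert i S"] in \<open>simp add: eq\<close>)
    also have "\<dots> \<le> C * norm \<xi>" using C by (intro mult_left_mono component_le_norm_cart)
    finally show ?case using 2 by (simp add: algebra_simps)
  qed
  from this[of UNIV] have "F (y UNIV) - F x \<le> C * real CARD('n) * norm \<xi>" .
  moreover have "y UNIV = x + \<xi>" by (simp add: y_def vec_eq_iff axis_def if_distrib cong: if_cong)
  ultimately show ?thesis by simp
qed

lemma heat_space_lipschitz:
  fixes w g :: "(real^'n::finite) \<times> real \<Rightarrow> real"
  assumes heat: "\<And>p. heat_op_at w p (g p)" and cont: "continuous_on UNIV w"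
    and g: "\<And>p. \<bar>g p\<bar> \<le> M" and w: "\<And>p. 0 \<le> w p \<and> w p \<le> 1"
  shows "w (y, t) - w (x, t) \<le> (real CARD('n) + M + 1) * real CARD('n) * norm (y - x)"
proof -
  have "M \<ge> 0" using g[of "(x, t)"] by linarith
  have "w (x + (y - x), t) - w (x, t) \<le> (real CARD('n) + M + 1) * real CARD('n) * norm (y - x)"
    by (rule lipschitz_of_coordinate_steps[where F = "\<lambda>x. w (x, t)"])
      (use \<open>M \<ge> 0\<close> heat_directional_lipschitz[OF heat cont g w] in auto)
  then show ?thesis by simp
qed

text \<open>
  A Lipschitz function lies below \<open>\<epsilon>\<close> plus a steep paraboloid centred at \<open>x\<close>; letting the paraboloid
  rise linearly in time keeps it above the solution. The condition on \<open>A\<close> is the discriminant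
  condition for $K\rho \le \epsilon + A\rho^2$; that it is at least 1 lets the paraboloid exceed all
  values of \<open>w\<close> at distance 1.
\<close>

lemma heat_time_growth:
  fixes w g :: "(real^'n::finite) \<times> real \<Rightarrow> real"
  assumes heat: "\<And>p. heat_op_at w p (g p)" and cont: "continuous_on UNIV w"
    and g: "\<And>p. \<bar>g p\<bar> \<le> M" and w: "\<And>p. 0 \<le> w p \<and> w p \<le> 1"
    and lip: "\<And>x y t. w (y, t) - w (x, t) \<le> K * norm (y - x)"
    and \<epsilon>: "0 < \<epsilon>" and st: "s \<le> t"
    and A: "1 \<le> A" "K^2 \<le> 4 * \<epsilon> * A"
  shows "w (x, t) - w (x, s) \<le> \<epsilon> + (2 * real CARD('n) * A + M + 1) * (t - s)"
proof -
  let ?B = "2 * real CARD('n) * A + M + 1"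
  define v where "v p = (w (x, s) + \<epsilon>) + A * ((fst p - x) \<bullet> (fst p - x)) + ?B * (snd p - s) - w p"
    for p
  have "M \<ge> 0" using g[of "(x, t)"] by linarith
  then have B: "?B \<ge> 0" using A by simp
  have "0 \<le> v (x, t)"
  proof (rule heat_minimum_principle[where ?t1.0 = s and ?t0.0 = t and
        \<Phi> = "\<lambda>p. (fst p - x) \<bullet> (fst p - x) - 1^2"])
    show "continuous_on UNIV v" unfolding v_def by (intro continuous_intros cont)
  next
    fix y r assume r: "s \<le> r" "r \<le> t" "(fst (y, r) - x) \<bullet> (fst (y, r) - x) - 1^2 \<le> 0"
      "r = s \<or> (fst (y, r) - x) \<bullet> (fst (y, r) - x) - 1^2 = 0"
    have Br: "?B * (r - s) \<ge> 0" using B r by simp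
    show "0 \<le> v (y, r)"
    proof (cases "r = s")
      case True
      define n where "n = norm (y - x)"
      have "4 * A * (K * n) \<le> 4 * A * (\<epsilon> + A * n^2)"
      proof -
        \<comment> \<open>Completing the square gives K n <= \<epsilon> + A n^2.\<close>
        have "(2 * A * n - K)^2 \<ge> 0" by simp
        then have "4 * A * (K * n) \<le> 4 * A^2 * n^2 + K^2"
          by (simp add: power2_eq_square algebra_simps)
        also have "\<dots> \<le> 4 * A^2 * n^2 + 4 * \<epsilon> * A" using A by simp
        finally show ?thesis by (simp add: power2_eq_square algebra_simps)
      qed
      then have "K * n \<le> \<epsilon> + A * n^2" using A by (simp del: mult_le_cancel_left_pos add: mult_le_cancel_left)
      with lip[of y s x] show ?thesis
        by (simp add: v_def True n_def power2_norm_eq_inner)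
    next
      case False
      then have "(y - x) \<bullet> (y - x) = 1" using r by simp
      then show ?thesis using Br A w[of "(y, r)"] w[of "(x, s)"] \<epsilon> by (simp add: v_def)
    qed
  next
    fix y r
    have "heat_op_at v (y, r) (0 + A * (- 2 * real CARD('n)) + ?B * 1 - g (y, r))"
      unfolding v_def
      by (intro heat_op_at_add heat_op_at_diff heat_op_at_scale heat_op_at_dist_sq
          heat_op_at_affine_time heat_op_at_const heat)
    moreover have "0 + A * (- 2 * real CARD('n)) + ?B * 1 - g (y, r) > 0"
      using g[of "(y, r)"] by (simp add: abs_le_iff)
    ultimately show "\<exists>g>0. heat_op_at v (y, r) g" by blast
  qed (use st bounded_cylinder[of s t x 1] in \<open>auto intro!: continuous_intros\<close>)
  then show ?thesis by (simp add: v_def)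
qed

text \<open>
  This replaces parabolic regularity theory: a bound for the solution and for its right-hand side
  yields a modulus of continuity valid on all of space-time.
\<close>

lemma heat_uniformly_continuous:
  fixes w g :: "(real^'n::finite) \<times> real \<Rightarrow> real"
  assumes heat: "\<And>p. heat_op_at w p (g p)" and cont: "continuous_on UNIV w"
    and g: "\<And>p. \<bar>g p\<bar> \<le> M" and w: "\<And>p. 0 \<le> w p \<and> w p \<le> 1"
  shows "uniformly_continuous_on UNIV w"
proof -
  define K where "K = (real CARD('n) + M + 1) * real CARD('n)"
  have M: "M \<ge> 0" using g[of 0] by linarith
  then have K: "K > 0" by (simp add: K_def zero_less_mult_iff)
  have heat': "heat_op_at (\<lambda>p. 1 - w p) p (0 - g p)" for p
    by (rule heat_op_at_diff[OF heat_op_at_const heat])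
  have cont': "continuous_on UNIV (\<lambda>p. 1 - w p)" by (intro continuous_intros cont)
  have space: "w (y, t) - w (x, t) \<le> K * norm (y - x)" for x y t
    unfolding K_def by (rule heat_space_lipschitz[OF heat cont g w])
  show ?thesis unfolding uniformly_continuous_on_def
  proof (intro allI impI)
    fix \<epsilon> :: real assume \<epsilon>: "0 < \<epsilon>"
    define A where "A = max 1 (K^2 / (4 * (\<epsilon> / 4)))"
    define B where "B = 2 * real CARD('n) * A + M + 1"
    have A: "1 \<le> A" "K^2 \<le> 4 * (\<epsilon> / 4) * A"
      using \<epsilon> by (auto simp: A_def max_def field_simps)
    have B: "B > 0" using A M by (simp add: B_def add_nonneg_pos)
    have time: "\<bar>w (x, t) - w (x, s)\<bar> \<le> \<epsilon> / 4 + B * (t - s)" if "s \<le> t" for x s t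
    proof -
      have "w (x, t) - w (x, s) \<le> \<epsilon> / 4 + B * (t - s)" unfolding B_def
        by (rule heat_time_growth[OF heat cont g w space _ that A]) (use \<epsilon> in auto)
      moreover have "(1 - w (x, t)) - (1 - w (x, s)) \<le> \<epsilon> / 4 + B * (t - s)" unfolding B_def
      proof (rule heat_time_growth[OF heat' cont' _ _ _ _ that A])
        show "(1 - w (y, t)) - (1 - w (x, t)) \<le> K * norm (y - x)" for x y t
          using space[where y = x and x = y and t = t] by (simp add: norm_minus_commute)
      qed (use g w \<epsilon> in auto)
      ultimately show ?thesis by linarith
    qed
    define d where "d = min (\<epsilon> / (4 * B)) (\<epsilon> / (4 * K))"
    have d: "d > 0" using B K \<epsilon> by (simp add: d_def)
    moreover have "dist (w q) (w p) < \<epsilon>" if "dist q p < d" for p q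
    proof -
      obtain x s y t where pq: "p = (x, s)" "q = (y, t)" by (cases p, cases q)
      have xy: "norm (y - x) < d" "\<bar>t - s\<bar> < d"
        using that dist_fst_le[of q p] dist_snd_le[of q p] by (auto simp: pq dist_norm)
      have "K * norm (y - x) < K * (\<epsilon> / (4 * K))"
        using xy(1) K by (intro mult_strict_left_mono) (simp_all add: d_def)
      then have 1: "K * norm (y - x) < \<epsilon> / 4" using K by simp
      have "B * \<bar>t - s\<bar> < B * (\<epsilon> / (4 * B))"
        using xy(2) B by (intro mult_strict_left_mono) (simp_all add: d_def)
      then have 2: "B * \<bar>t - s\<bar> < \<epsilon> / 4" using B by simp
      have "\<bar>w (y, t) - w (y, s)\<bar> \<le> \<epsilon> / 4 + B * \<bar>t - s\<bar>"
        using time[of s t y] time[of t s y] by (cases "s \<le> t") (auto simp: abs_minus_commute)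
      moreover have "\<bar>w (y, s) - w (x, s)\<bar> \<le> K * norm (y - x)"
        using space[of y s x] space[of x s y] by (simp add: norm_minus_commute abs_le_iff)
      ultimately show ?thesis using 1 2 by (simp add: pq dist_real_def abs_le_iff) linarith
    qed
    ultimately show "\<exists>d>0. \<forall>p\<in>UNIV. \<forall>q\<in>UNIV. dist q p < d \<longrightarrow> dist (w q) (w p) < \<epsilon>"
      by blast
  qed
qed

section \<open>Propagation of positivity\<close>

text \<open>
  With $c = 4rV + 4N + 8$ the claim is that $(A-\Lambda) q^2 - c q + 8 r^2$ is positive. The decay rate
  \<open>A\<close> is chosen so that the discriminant of this quadratic is negative; its
  constant term stems from the gradient of \<open>q\<close>, which does not vanish at the boundary of the ball.
\<close>

lemma bump_strict_subsolution:
  fixes q r V \<Lambda> N m :: real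
  assumes r: "0 < r" and q: "0 \<le> q" and N: "0 \<le> N" and V: "0 \<le> V"
    and m: "m \<le> r * V"
    and A: "A = \<Lambda> + (4 * r * V + 4 * N + 8)^2 / (16 * r^2)"
  shows "4 * q * m - A * q^2 - 8 * (r^2 - q) + 4 * N * q < - \<Lambda> * q^2"
proof -
  define c where "c = 4 * r * V + 4 * N + 8"
  have "4 * q * m \<le> 4 * q * (r * V)" using q m by (intro mult_left_mono) auto
  moreover have "(c * q / (4 * r) - 2 * r)^2 = c^2 / (16 * r^2) * q^2 - c * q + 4 * r^2"
    using r by (simp add: power2_eq_square field_simps)
  moreover have "(c * q / (4 * r) - 2 * r)^2 \<ge> 0" by simp
  moreover have "c * q = 4 * q * (r * V) + 4 * N * q + 8 * q" by (simp add: c_def algebra_simps)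
  moreover have "A * q^2 = \<Lambda> * q^2 + c^2 / (16 * r^2) * q^2"
    by (simp add: A c_def algebra_simps)
  moreover have "0 < r^2" using r by simp
  ultimately show ?thesis by (simp only: right_diff_distrib minus_mult_left[symmetric])
qed

text \<open>
  A quantitative strong maximum principle: a lower bound on a ball is carried along any line
  of finite velocity, losing only an exponential factor that depends on the
  ball, on the velocity and on the elapsed time, but not on \<open>z\<close>. The moving bump lies below \<open>z\<close>
  initially, vanishes on the side of the moving ball, and is a strict subsolution.
\<close>

lemma positivity_propagates:
  fixes z k :: "(real^'n::finite) \<times> real \<Rightarrow> real" and \<xi> x1 :: "real^'n"
  assumes heat: "\<And>p. heat_op_at z p (k p)" and cont: "continuous_on UNIV z"
    and k: "\<And>p. - \<Lambda> * z p \<le> k p" and \<Lambda>: "0 \<le> \<Lambda>" and z: "\<And>p. 0 \<le> z p"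
    and r: "0 < r" and \<eta>: "0 < \<eta>" and t: "t1 \<le> t"
    and start: "\<And>x. norm (x - x1) \<le> r \<Longrightarrow> \<eta> \<le> z (x, t1)"
    and A: "A = \<Lambda> + (4 * r * norm \<xi> + 4 * real CARD('n) + 8)^2 / (16 * r^2)"
  shows "\<eta> * exp (- A * (t - t1)) \<le> z (x1 + (t - t1) *\<^sub>R \<xi>, t)"
proof -
  define Y where "Y p = fst p - x1 - (snd p - t1) *\<^sub>R \<xi>" for p :: "(real^'n) \<times> real"
  define \<kappa> where "\<kappa> = \<eta> / (r^2)^2"
  define \<phi> where "\<phi> p = \<kappa> * (exp (- A * (snd p - t1)) * (r^2 - Y p \<bullet> Y p)^2)" for p
  define v where "v p = z p - \<phi> p" for p
  have \<kappa>: "0 < \<kappa>" using r \<eta> by (simp add: \<kappa>_def)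
  have contY: "continuous_on UNIV Y" unfolding Y_def by (intro continuous_intros)
  have "0 \<le> v (x1 + (t - t1) *\<^sub>R \<xi>, t)"
  proof (rule heat_minimum_principle[where ?t1.0 = t1 and ?t0.0 = t and \<Phi> = "\<lambda>p. Y p \<bullet> Y p - r^2"])
    have "norm (x - x1) \<le> r + \<bar>t - t1\<bar> * norm \<xi>"
      if "t1 \<le> s" "s \<le> t" "Y (x, s) \<bullet> Y (x, s) \<le> r^2" for x s
    proof -
      have "norm (x - x1) \<le> norm (Y (x, s)) + norm ((s - t1) *\<^sub>R \<xi>)"
        using norm_triangle_ineq[of "Y (x, s)" "(s - t1) *\<^sub>R \<xi>"] by (simp add: Y_def)
      moreover have "norm (Y (x, s)) \<le> r" using that(3) r by (simp add: norm_le_square)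
      moreover have "norm ((s - t1) *\<^sub>R \<xi>) \<le> \<bar>t - t1\<bar> * norm \<xi>"
        using that by (auto intro!: mult_right_mono)
      ultimately show ?thesis by linarith
    qed
    then have "{p. t1 \<le> snd p \<and> snd p \<le> t \<and> Y p \<bullet> Y p - r^2 \<le> 0}
        \<subseteq> cball x1 (r + \<bar>t - t1\<bar> * norm \<xi>) \<times> {t1..t}"
      by (auto simp: dist_norm norm_minus_commute)
    then show "bounded {p. t1 \<le> snd p \<and> snd p \<le> t \<and> Y p \<bullet> Y p - r^2 \<le> 0}"
      by (rule bounded_subset[rotated]) (auto intro!: bounded_Times)
    show "continuous_on UNIV (\<lambda>p. Y p \<bullet> Y p - r^2)" by (intro continuous_intros contY)
    show "continuous_on UNIV v" unfolding v_def \<phi>_def by (intro continuous_intros contY cont)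
  next
    fix x s assume s: "t1 \<le> s" "s \<le> t" "Y (x, s) \<bullet> Y (x, s) - r^2 \<le> 0"
      "s = t1 \<or> Y (x, s) \<bullet> Y (x, s) - r^2 = 0"
    show "0 \<le> v (x, s)"
    proof (cases "Y (x, s) \<bullet> Y (x, s) - r^2 = 0")
      case True
      then show ?thesis using z[of "(x, s)"] by (simp add: v_def \<phi>_def)
    next
      case False
      with s have s1: "s = t1" by simp
      then have Y: "Y (x, s) = x - x1" by (simp add: Y_def)
      have "norm (x - x1) \<le> r" using s(3) r by (simp add: Y norm_le_square)
      then have "\<eta> \<le> z (x, t1)" by (rule start)
      moreover have "(r^2 - Y (x, s) \<bullet> Y (x, s))^2 \<le> (r^2)^2"
        using s(3) by (intro power_mono) auto
      then have "\<kappa> * (r^2 - Y (x, s) \<bullet> Y (x, s))^2 \<le> \<kappa> * (r^2)^2" using \<kappa> by simp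
      then have "\<phi> (x, s) \<le> \<eta>" using r by (simp add: \<phi>_def s1 \<kappa>_def)
      ultimately show ?thesis by (simp add: v_def s1)
    qed
  next
    fix x s assume s: "t1 < s" "s \<le> t" "Y (x, s) \<bullet> Y (x, s) - r^2 < 0" "v (x, s) < 0"
    define y q E where "y = Y (x, s)" and "q = r^2 - y \<bullet> y" and "E = exp (- A * (s - t1))"
    have \<phi>: "\<phi> (x, s) = \<kappa> * (E * q^2)" by (simp add: \<phi>_def E_def q_def y_def)
    define B where "B = 4 * q * (y \<bullet> \<xi>) - A * q^2 - 8 * (y \<bullet> y) + 4 * real CARD('n) * q"
    have "heat_op_at \<phi> (x, s) (\<kappa> * (E * B))"
      unfolding \<phi>_def Y_def E_def B_def
      by (rule heat_op_at_scale, rule heat_op_at_moving_bump) (auto simp: y_def Y_def q_def)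
    then have "heat_op_at v (x, s) (k (x, s) - \<kappa> * (E * B))"
      unfolding v_def by (rule heat_op_at_diff[OF heat])
    moreover have "k (x, s) - \<kappa> * (E * B) > 0"
    proof -
      have "norm y \<le> r" using s(3) r by (simp add: y_def norm_le_square)
      then have "y \<bullet> \<xi> \<le> r * norm \<xi>"
        by (intro order_trans[OF norm_cauchy_schwarz] mult_right_mono) auto
      then have "B < - \<Lambda> * q^2"
        using bump_strict_subsolution[of r q "real CARD('n)" "norm \<xi>" "y \<bullet> \<xi>" A \<Lambda>] r s(3) A
        by (simp add: B_def q_def y_def)
      then have "\<kappa> * (E * B) < \<kappa> * (E * (- \<Lambda> * q^2))"
        using \<kappa> by (intro mult_strict_left_mono) (auto simp: E_def)
      also have "\<dots> = - \<Lambda> * \<phi> (x, s)" by (simp add: \<phi>)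
      also have "\<dots> \<le> - \<Lambda> * z (x, s)" using \<Lambda> s(4) by (simp add: v_def mult_left_mono)
      also have "\<dots> \<le> k (x, s)" by (rule k)
      finally show ?thesis by simp
    qed
    ultimately show "\<exists>g>0. heat_op_at v (x, s) g" by blast
  qed (use t r in \<open>auto simp: Y_def\<close>)
  then show ?thesis using r by (simp add: v_def \<phi>_def Y_def \<kappa>_def mult_ac)
qed

section \<open>Sliding along a space-time direction\<close>

text \<open>
  The solution is compared with its translates along the direction \<open>(\<xi>, 1)\<close>. The graph of \<open>h\<close>
  is the front: above it \<open>u\<close> is at least \<open>\<theta>\<close> and already increases along the direction; far
  below it \<open>u\<close> is uniformly small. The direction is steeper than the front, so moving along it
  crosses the front at a uniform rate.
\<close>

locale sliding_front =
  fixes f :: "real \<Rightarrow> real" and u :: "(real^'n::finite) \<times> real \<Rightarrow> real"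
    and h :: "real^'n \<Rightarrow> real" and \<xi> :: "real^'n" and \<Lambda> L \<theta> \<delta>\<^sub>0 :: real
  assumes heat: "\<And>p. heat_op_at u p (f (u p))" and cont: "continuous_on UNIV u"
    and range: "\<And>p. 0 < u p" "\<And>p. u p < 1"
    and f_lip: "\<Lambda>-lipschitz_on {0..1} f"
    and \<delta>\<^sub>0: "0 < \<delta>\<^sub>0" and f_antimono: "\<And>r s. 0 < r \<Longrightarrow> r \<le> s \<Longrightarrow> s < \<delta>\<^sub>0 \<Longrightarrow> f s \<le> f r"
    and front: "\<And>x t. \<theta> \<le> u (x, t) \<longleftrightarrow> h x \<le> t"
    and h_lip: "L-lipschitz_on UNIV h"
    and decay: "\<And>\<epsilon>. 0 < \<epsilon> \<Longrightarrow> \<exists>R. \<forall>x t. R \<le> h x - t \<longrightarrow> u (x, t) < \<epsilon>"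
    and steep: "L * norm \<xi> < 1"
    and above: "\<And>x t \<tau>. h x \<le> t \<Longrightarrow> 0 \<le> \<tau> \<Longrightarrow> u (x, t) \<le> u (x + \<tau> *\<^sub>R \<xi>, t + \<tau>)"
begin

definition shift :: "real \<Rightarrow> (real^'n) \<times> real \<Rightarrow> (real^'n) \<times> real" where
  "shift \<tau> p = p + \<tau> *\<^sub>R (\<xi>, 1)"

definition ordered :: "real \<Rightarrow> bool" where
  "ordered \<tau> \<longleftrightarrow> (\<forall>p. u p \<le> u (shift \<tau> p))"

lemma shift_Pair: "shift \<tau> (x, t) = (x + \<tau> *\<^sub>R \<xi>, t + \<tau>)"
  by (simp add: shift_def)

lemma continuous_shift: "continuous_on UNIV (\<lambda>p. u (shift \<tau> p))"
  unfolding shift_def by (intro continuous_on_compose2[OF cont] continuous_intros) auto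

lemma heat_shift_diff:
  "heat_op_at (\<lambda>p. u (shift \<tau> p) - u p) p (f (u (shift \<tau> p)) - f (u p))"
  unfolding shift_def by (intro heat_op_at_diff heat heat_op_at_translate)

lemma u_uniformly_continuous: "uniformly_continuous_on UNIV u"
proof (rule heat_uniformly_continuous[OF heat cont])
  fix p
  have "\<bar>f (u p) - f 0\<bar> \<le> \<Lambda> * \<bar>u p - 0\<bar>"
    using lipschitz_onD[OF f_lip, of "u p" 0] range[of p] by (simp add: dist_real_def)
  also have "\<dots> \<le> \<Lambda> * 1"
    using range[of p] lipschitz_on_nonneg[OF f_lip] by (intro mult_left_mono) auto
  finally show "\<bar>f (u p)\<bar> \<le> \<bar>f 0\<bar> + \<Lambda>" by linarith
  show "0 \<le> u p \<and> u p \<le> 1" using range[of p] by auto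
qed

lemma h_growth: "h y \<le> h x + L * norm (y - x)"
  using lipschitz_onD[OF h_lip, of y x] by (auto simp: dist_norm abs_le_iff)

text \<open>
  Sliding forward reduces the depth below the front at least at the rate \<open>1 - L * norm \<xi>\<close>.
\<close>

lemma depth_shift: "h (x + \<tau> *\<^sub>R \<xi>) - (t + \<tau>) \<le> h x - t + L * norm \<xi> * \<bar>\<tau>\<bar> - \<tau>"
  using h_growth[of "x + \<tau> *\<^sub>R \<xi>" x] by (simp add: mult_ac)

text \<open>
  The comparison only needs to be known in the strip between \<open>\<delta>\<close> and \<open>\<theta>\<close>. Where \<open>u < \<delta>\<close> and the
  difference \<open>z\<close> is negative, both values lie in the range where \<open>f\<close> is nonincreasing, so \<open>z\<close> is
  a supersolution of the heat equation there. Since the domain is unbounded and has no initial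
  time, a negative value is excluded by a barrier on large backward cylinders: going back a time
  proportional to the radius \<open>\<rho>\<close> brings the whole ball far below the front, because the front is
  Lipschitz, and there \<open>z\<close> is at least \<open>-\<epsilon>\<close>. The barrier $|x-x_0|^2/\rho^2$ exceeds 1 on the side
  of the cylinder, while the heat flow raises it at the centre only by an amount of order
  $T/\rho^2$, which tends to 0 as \<open>T\<close> is linear in \<open>\<rho>\<close>.
\<close>

lemma ordered_of_middle:
  assumes \<delta>: "0 < \<delta>" "\<delta> \<le> \<delta>\<^sub>0" and \<tau>: "0 \<le> \<tau>"
    and middle: "\<And>p. \<delta> \<le> u p \<Longrightarrow> u p < \<theta> \<Longrightarrow> u p \<le> u (shift \<tau> p)"
  shows "ordered \<tau>"
proof -
  define z where "z p = u (shift \<tau> p) - u p" for p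
  have high: "0 \<le> z p" if "\<delta> \<le> u p" for p
  proof (cases p)
    case (Pair x t)
    show ?thesis
    proof (cases "\<theta> \<le> u p")
      case True
      then show ?thesis using above[of x t \<tau>] front[of x t] \<tau> by (simp add: z_def Pair shift_Pair)
    qed (use middle[OF that] in \<open>simp add: z_def\<close>)
  qed
  have "0 \<le> z (x0, t0) + \<epsilon>'" if "0 < \<epsilon>'" for x0 t0 \<epsilon>'
  proof -
    let ?N = "2 * real CARD('n) + 1"
    define \<epsilon> where "\<epsilon> = \<epsilon>' / 2"
    have \<epsilon>: "\<epsilon> > 0" using that by (simp add: \<epsilon>_def)
    obtain R where R: "\<And>x t. R \<le> h x - t \<Longrightarrow> u (x, t) < \<epsilon>" using decay[OF \<epsilon>] by blast
    \<comment> \<open>The time T = a + L \<rho> suffices to bring the ball of radius \<rho> around x0 to depth R.\<close>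
    define a where "a = \<bar>R\<bar> + \<bar>t0 - h x0\<bar>"
    define \<rho> where "\<rho> = max 1 (?N * (a + L) / \<epsilon>)"
    define T where "T = a + L * \<rho>"
    define t1 where "t1 = t0 - T"
    have L: "L \<ge> 0" by (rule lipschitz_on_nonneg[OF h_lip])
    have a: "a \<ge> 0" by (simp add: a_def)
    have \<rho>: "\<rho> \<ge> 1" by (simp add: \<rho>_def)
    have T: "T \<ge> 0" using a L \<rho> by (simp add: T_def)
    have small: "?N * T / \<rho>^2 \<le> \<epsilon>"
    proof -
      have "a * 1 \<le> a * \<rho>" using a \<rho> by (intro mult_left_mono)
      then have "T \<le> (a + L) * \<rho>" by (simp add: T_def algebra_simps)
      then have "?N * T \<le> ?N * (a + L) * \<rho>" by simp
      also have "?N * (a + L) \<le> \<epsilon> * \<rho>"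
        using \<epsilon> by (simp add: \<rho>_def max_def field_simps)
      then have "?N * (a + L) * \<rho> \<le> \<epsilon> * \<rho> * \<rho>" using \<rho> by (intro mult_right_mono) auto
      finally show ?thesis using \<rho> by (simp add: divide_le_eq power2_eq_square mult_ac)
    qed
    define v where "v p = z p + \<epsilon> + 1 / \<rho>^2 * ((fst p - x0) \<bullet> (fst p - x0) + ?N * (snd p - t1))" for p
    have "0 \<le> v (x0, t0)"
    proof (rule heat_minimum_principle[where ?t1.0 = t1 and ?t0.0 = t0 and
          \<Phi> = "\<lambda>p. (fst p - x0) \<bullet> (fst p - x0) - \<rho>^2"])
      show "bounded {p. t1 \<le> snd p \<and> snd p \<le> t0 \<and> (fst p - x0) \<bullet> (fst p - x0) - \<rho>^2 \<le> 0}"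
        by (rule bounded_cylinder)
      show "continuous_on UNIV (\<lambda>p :: (real^'n) \<times> real. (fst p - x0) \<bullet> (fst p - x0) - \<rho>^2)"
        by (intro continuous_intros)
      show "continuous_on UNIV v" unfolding v_def z_def
        by (intro continuous_intros cont continuous_shift)
    next
      fix x s assume s: "t1 \<le> s" "s \<le> t0" "(fst (x, s) - x0) \<bullet> (fst (x, s) - x0) - \<rho>^2 \<le> 0"
        "s = t1 \<or> (fst (x, s) - x0) \<bullet> (fst (x, s) - x0) - \<rho>^2 = 0"
      have zu: "- u (x, s) < z (x, s)" using range(1)[of "shift \<tau> (x, s)"] by (simp add: z_def)
      have nn: "0 \<le> ?N * (s - t1)" using s by simp
      show "0 \<le> v (x, s)"
      proof (cases "s = t1")
        case True
        have "norm (x0 - x) \<le> \<rho>"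
          using s(3) \<rho> by (simp add: norm_le_square norm_minus_commute[of x0])
        then have "L * norm (x0 - x) \<le> L * \<rho>" using L by (intro mult_left_mono)
        then have "R \<le> h x - s" using h_growth[of x0 x] by (simp add: True t1_def T_def a_def)
        then have "u (x, s) < \<epsilon>" by (rule R)
        with zu have "0 < z (x, s) + \<epsilon>" by simp
        then show ?thesis using nn by (simp add: v_def add_pos_nonneg less_imp_le)
      next
        case False
        then have "(x - x0) \<bullet> (x - x0) = \<rho>^2" using s by simp
        then have "1 / \<rho>^2 * ((x - x0) \<bullet> (x - x0) + ?N * (s - t1)) \<ge> 1 / \<rho>^2 * (\<rho>^2)"
          using nn by (intro mult_left_mono) auto
        then have "1 / \<rho>^2 * ((x - x0) \<bullet> (x - x0) + ?N * (s - t1)) \<ge> 1" using \<rho> by simp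
        then show ?thesis using zu range(2)[of "(x, s)"] \<epsilon> unfolding v_def fst_conv snd_conv by linarith
      qed
    next
      fix x s assume s: "t1 < s" "v (x, s) < 0"
      have "0 \<le> 1 / \<rho>^2 * ((x - x0) \<bullet> (x - x0) + ?N * (s - t1))" using s by simp
      then have z: "z (x, s) < 0" using s(2) \<epsilon> unfolding v_def fst_conv snd_conv by linarith
      have le: "f (u (x, s)) \<le> f (u (shift \<tau> (x, s)))"
        using z high[of "(x, s)"] \<delta>(2)
        by (intro f_antimono range) (force simp: z_def)+
      have "heat_op_at v (x, s)
          ((f (u (shift \<tau> (x, s))) - f (u (x, s))) + 0 + 1 / \<rho>^2 * (- 2 * real CARD('n) + ?N * 1))"
        unfolding v_def z_def
        by (intro heat_op_at_add heat_op_at_scale heat_op_at_dist_sq heat_op_at_affine_time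
            heat_op_at_const heat_shift_diff)
      moreover have "1 / \<rho>^2 * (- 2 * real CARD('n) + ?N * 1) > 0" using \<rho> by simp
      then have "(f (u (shift \<tau> (x, s))) - f (u (x, s))) + 0 + 1 / \<rho>^2 * (- 2 * real CARD('n) + ?N * 1) > 0"
        using le by linarith
      ultimately show "\<exists>g>0. heat_op_at v (x, s) g" by blast
    qed (use T in \<open>auto simp: t1_def\<close>)
    then have "0 \<le> z (x0, t0) + \<epsilon> + ?N * T / \<rho>^2" by (simp add: v_def t1_def)
    moreover have "\<epsilon>' = \<epsilon> + \<epsilon>" by (simp add: \<epsilon>_def)
    ultimately show ?thesis using small by linarith
  qed
  then have "0 \<le> z p" for p by (cases p) (metis field_le_epsilon)
  then show ?thesis by (simp add: ordered_def z_def)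
qed

text \<open>
  The strip between \<open>\<delta>\<^sub>0\<close> and \<open>\<theta>\<close> has bounded depth, so a large shift moves it above the front.
\<close>

lemma ordered_eventually: "\<exists>T\<ge>0. \<forall>\<tau>\<ge>T. ordered \<tau>"
proof -
  obtain R where R: "\<And>x t. R \<le> h x - t \<Longrightarrow> u (x, t) < \<delta>\<^sub>0" using decay[OF \<delta>\<^sub>0] by blast
  define m where "m = 1 - L * norm \<xi>"
  have m: "m > 0" using steep by (simp add: m_def)
  have "ordered \<tau>" if \<tau>: "\<bar>R\<bar> / m \<le> \<tau>" for \<tau>
  proof (rule ordered_of_middle[OF \<delta>\<^sub>0 order_refl])
    have "0 \<le> \<bar>R\<bar> / m" using m by simp
    then show \<tau>0: "0 \<le> \<tau>" using \<tau> by linarith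
    fix p assume p: "\<delta>\<^sub>0 \<le> u p" "u p < \<theta>"
    obtain x t where xt: "p = (x, t)" by (cases p)
    have "h x - t < R" using R[of x t] p by (force simp: xt)
    moreover have "R \<le> m * \<tau>" using \<tau> m by (simp add: divide_le_eq mult.commute)
    moreover have "h (x + \<tau> *\<^sub>R \<xi>) - (t + \<tau>) \<le> h x - t - m * \<tau>"
      using depth_shift[of x \<tau> t] \<tau>0 by (simp add: m_def algebra_simps)
    ultimately have "h (x + \<tau> *\<^sub>R \<xi>) \<le> t + \<tau>" by linarith
    then have "\<theta> \<le> u (shift \<tau> p)" using front by (simp add: xt shift_Pair)
    with p show "u p \<le> u (shift \<tau> p)" by simp
  qed
  moreover have "0 \<le> \<bar>R\<bar> / m" using m by simp
  ultimately show ?thesis by blast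
qed

text \<open>
  This plays the role of the strong maximum principle combined with a compactness argument. Going
  back from \<open>p\<close> in a fixed number \<open>N'\<close> of steps of length \<open>\<tau>\<close> leads from a value at least \<open>\<delta>\<close> to
  a value below \<open>\<delta> / 2\<close>, so at one of the steps \<open>u\<close> increases by at least \<open>\<delta> / (2 * N')\<close>. By
  uniform continuity this increase persists on a ball of fixed radius, and positivity of the
  difference propagates from there along the sliding direction up to \<open>p\<close>. All constants are
  independent of \<open>p\<close>.
\<close>

lemma increase_bounded_below:
  assumes ord: "ordered \<tau>" and \<tau>: "0 < \<tau>" and \<delta>: "0 < \<delta>"
  shows "\<exists>\<eta>>0. \<forall>p. \<delta> \<le> u p \<and> u p < \<theta> \<longrightarrow> u p + \<eta> \<le> u (shift \<tau> p)"
proof -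
  define z where "z p = u (shift \<tau> p) - u p" for p
  have z: "0 \<le> z p" for p using ord by (simp only: ordered_def z_def diff_ge_0_iff_ge)
  define m where "m = 1 - L * norm \<xi>"
  have m: "m > 0" using steep by (simp add: m_def)
  obtain R where R: "\<And>x t. R \<le> h x - t \<Longrightarrow> u (x, t) < \<delta> / 2" using decay[of "\<delta> / 2"] \<delta> by auto
  obtain N where N: "R / (m * \<tau>) < real N" using reals_Archimedean2 by blast
  define N' where "N' = Suc N"
  have "R / (m * \<tau>) \<le> real N'" using N by (simp add: N'_def)
  then have RN: "R \<le> real N' * \<tau> * m" using m \<tau> by (simp add: divide_le_eq mult_ac)
  have N': "N' > 0" by (simp add: N'_def)
  define \<eta>\<^sub>1 where "\<eta>\<^sub>1 = \<delta> / (4 * real N')"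
  have \<eta>\<^sub>1: "\<eta>\<^sub>1 > 0" using \<delta> N' by (simp add: \<eta>\<^sub>1_def)
  obtain d where d: "d > 0" "\<And>p q. dist p q < d \<Longrightarrow> dist (u p) (u q) < \<eta>\<^sub>1 / 2"
    using u_uniformly_continuous[unfolded uniformly_continuous_on_def, rule_format, of "\<eta>\<^sub>1 / 2"] \<eta>\<^sub>1
    by auto
  define r where "r = d / 2"
  have r: "r > 0" using d by (simp add: r_def)
  have \<Lambda>: "\<Lambda> \<ge> 0" by (rule lipschitz_on_nonneg[OF f_lip])
  define A where "A = \<Lambda> + (4 * r * norm \<xi> + 4 * real CARD('n) + 8)^2 / (16 * r^2)"
  have A: "A \<ge> 0" using \<Lambda> by (simp add: A_def)
  have k: "- \<Lambda> * z p \<le> f (u (shift \<tau> p)) - f (u p)" for p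
    using lipschitz_onD[OF f_lip, of "u (shift \<tau> p)" "u p"] range[of p] range[of "shift \<tau> p"] z[of p]
    by (auto simp: dist_real_def z_def abs_le_iff less_imp_le)
  have "u p + \<eta>\<^sub>1 * exp (- A * (real N' * \<tau>)) \<le> u (shift \<tau> p)" if p: "\<delta> \<le> u p" "u p < \<theta>" for p
  proof -
    obtain x0 t0 where xt: "p = (x0, t0)" by (cases p)
    have t0: "t0 < h x0" using front[of x0 t0] p by (simp add: xt)
    define a where "a i = u (shift (- (real i * \<tau>)) p)" for i
    have a0: "\<delta> \<le> a 0" using p by (simp add: a_def shift_def zero_prod_def[symmetric])
    have aN: "a N' < \<delta> / 2"
    proof -
      have "h x0 - t0 \<le> (h (x0 + - (real N' * \<tau>) *\<^sub>R \<xi>) - (t0 + - (real N' * \<tau>))) + L * norm \<xi> * (real N' * \<tau>) - real N' * \<tau>"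
        using depth_shift[of "x0 + - (real N' * \<tau>) *\<^sub>R \<xi>" "real N' * \<tau>" "t0 + - (real N' * \<tau>)"] \<tau> by simp
      then have "R \<le> h (x0 + - (real N' * \<tau>) *\<^sub>R \<xi>) - (t0 + - (real N' * \<tau>))"
        using RN t0 by (simp add: m_def algebra_simps)
      then show ?thesis using R by (simp only: a_def xt shift_Pair)
    qed
    \<comment> \<open>The increments telescope to more than \<delta> / 2, hence one of them is at least the average.\<close>
    have "\<exists>i<N'. 2 * \<eta>\<^sub>1 \<le> a i - a (Suc i)"
    proof (rule ccontr)
      assume "\<not> ?thesis"
      then have "(\<Sum>i<N'. a i - a (Suc i)) \<le> (\<Sum>i<N'. 2 * \<eta>\<^sub>1)" by (intro sum_mono) auto
      also have "\<dots> = \<delta> / 2" using N' by (simp add: \<eta>\<^sub>1_def)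
      also have "(\<Sum>i<N'. a i - a (Suc i)) = a 0 - a N'" by (rule sum_lessThan_telescope')
      finally show False using a0 aN by simp
    qed
    then obtain i where i: "i < N'" "2 * \<eta>\<^sub>1 \<le> a i - a (Suc i)" by blast
    define T where "T = real (Suc i) * \<tau>"
    define x1 t1 where "x1 = x0 - T *\<^sub>R \<xi>" and "t1 = t0 - T"
    have T: "0 \<le> T" "T \<le> real N' * \<tau>" using i \<tau> by (auto simp: T_def intro!: mult_right_mono)
    have "a (Suc i) = u (x1, t1)" by (simp only: a_def xt shift_Pair x1_def t1_def T_def) simp
    moreover have "a i = u (shift \<tau> (x1, t1))"
      by (simp only: a_def xt shift_Pair x1_def t1_def T_def) (simp add: algebra_simps)
    ultimately have z1: "2 * \<eta>\<^sub>1 \<le> z (x1, t1)" using i by (simp add: z_def)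
    have "\<eta>\<^sub>1 * exp (- A * (t0 - t1)) \<le> z (x1 + (t0 - t1) *\<^sub>R \<xi>, t0)"
    proof (rule positivity_propagates[OF _ _ k \<Lambda> z r \<eta>\<^sub>1 _ _ A_def])
      show "heat_op_at z p (f (u (shift \<tau> p)) - f (u p))" for p
        unfolding z_def by (rule heat_shift_diff)
      show "continuous_on UNIV z"
        unfolding z_def by (intro continuous_intros continuous_shift cont)
      fix x assume x: "norm (x - x1) \<le> r"
      have "dist (x, t1) (x1, t1) < d" "dist (shift \<tau> (x, t1)) (shift \<tau> (x1, t1)) < d"
        using x d(1) by (simp_all add: dist_Pair_Pair shift_Pair dist_norm r_def)
      from d(2)[OF this(1)] d(2)[OF this(2)] z1 show "\<eta>\<^sub>1 \<le> z (x, t1)"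
        unfolding z_def dist_real_def by linarith
    qed (use T in \<open>simp add: t1_def\<close>)
    then have "\<eta>\<^sub>1 * exp (- A * T) \<le> z p" by (simp add: x1_def t1_def xt)
    moreover have "\<eta>\<^sub>1 * exp (- A * (real N' * \<tau>)) \<le> \<eta>\<^sub>1 * exp (- A * T)"
      using \<eta>\<^sub>1 A T by (intro mult_left_mono) (auto intro!: mult_left_mono)
    ultimately show ?thesis by (simp add: z_def)
  qed
  moreover have "0 < \<eta>\<^sub>1 * exp (- A * (real N' * \<tau>))" using \<eta>\<^sub>1 by simp
  ultimately show ?thesis by blast
qed

text \<open>
  On the strip there is room to spare, and uniform continuity in the sliding direction uses it;
  outside the strip \<open>ordered_of_middle\<close> needs no room.
\<close>

lemma ordered_nearby:
  assumes ord: "ordered \<tau>" and \<tau>: "0 < \<tau>"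
  shows "\<exists>\<sigma>>0. \<forall>\<tau>'\<ge>0. \<bar>\<tau>' - \<tau>\<bar> < \<sigma> \<longrightarrow> ordered \<tau>'"
proof -
  obtain \<eta> where \<eta>: "\<eta> > 0" "\<And>p. \<delta>\<^sub>0 \<le> u p \<Longrightarrow> u p < \<theta> \<Longrightarrow> u p + \<eta> \<le> u (shift \<tau> p)"
    using increase_bounded_below[OF ord \<tau> \<delta>\<^sub>0] by blast
  obtain d where d: "d > 0" "\<And>p q. dist p q < d \<Longrightarrow> dist (u p) (u q) < \<eta>"
    using u_uniformly_continuous[unfolded uniformly_continuous_on_def, rule_format, of \<eta>] \<eta>(1)
    by auto
  define V where "V = norm (\<xi>, 1::real)"
  have V: "V > 0" by (simp add: V_def zero_prod_def)
  have "ordered \<tau>'" if \<tau>': "0 \<le> \<tau>'" "\<bar>\<tau>' - \<tau>\<bar> < d / V" for \<tau>'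
  proof (rule ordered_of_middle[OF \<delta>\<^sub>0 order_refl \<tau>'(1)])
    fix p assume p: "\<delta>\<^sub>0 \<le> u p" "u p < \<theta>"
    have "dist (shift \<tau>' p) (shift \<tau> p) = \<bar>\<tau>' - \<tau>\<bar> * V"
      unfolding shift_def V_def dist_norm add_diff_cancel_left scaleR_diff_left[symmetric]
      by (rule norm_scaleR)
    then have "dist (shift \<tau>' p) (shift \<tau> p) < d" using \<tau>'(2) V by (simp add: less_divide_eq)
    from d(2)[OF this] \<eta>(2)[OF p] show "u p \<le> u (shift \<tau>' p)"
      unfolding dist_real_def by linarith
  qed
  moreover have "d / V > 0" using d V by simp
  ultimately show ?thesis by blast
qed

text \<open>
  The set of shifts beyond which all translates are ordered is closed by continuity and open on the
  positive side by \<open>ordered_nearby\<close>, so its infimum is 0.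
\<close>

lemma ordered_nonneg:
  assumes "0 \<le> \<tau>"
  shows "ordered \<tau>"
proof -
  define S where "S = {\<tau>. 0 \<le> \<tau> \<and> (\<forall>\<sigma>\<ge>\<tau>. ordered \<sigma>)}"
  define m where "m = Inf S"
  have S: "S \<noteq> {}" "bdd_below S"
    using ordered_eventually by (auto simp: S_def intro!: bdd_belowI[of _ 0])
  have m0: "m \<ge> 0" unfolding m_def using S(1) by (intro cInf_greatest) (auto simp: S_def)
  have gt: "ordered \<sigma>" if "m < \<sigma>" for \<sigma>
    using that S cInf_less_iff[of S \<sigma>] by (auto simp: m_def S_def)
  have ge: "ordered \<sigma>" if "m \<le> \<sigma>" for \<sigma>
    unfolding ordered_def
  proof
    fix p
    have "continuous_on UNIV (\<lambda>\<sigma>. u (shift \<sigma> p))"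
      unfolding shift_def by (intro continuous_on_compose2[OF cont] continuous_intros) auto
    then have "closed {\<sigma>. u p \<le> u (shift \<sigma> p)}" by (intro closed_Collect_le continuous_intros)
    moreover have "{m<..} \<subseteq> {\<sigma>. u p \<le> u (shift \<sigma> p)}" using gt unfolding ordered_def by blast
    ultimately have "closure {m<..} \<subseteq> {\<sigma>. u p \<le> u (shift \<sigma> p)}" by (intro closure_minimal)
    then show "u p \<le> u (shift \<sigma> p)" using that by auto
  qed
  have "m = 0"
  proof (rule ccontr)
    assume "m \<noteq> 0"
    then have "m > 0" using m0 by simp
    then obtain \<sigma> where \<sigma>: "\<sigma> > 0" "\<And>\<tau>'. 0 \<le> \<tau>' \<Longrightarrow> \<bar>\<tau>' - m\<bar> < \<sigma> \<Longrightarrow> ordered \<tau>'"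
      using ordered_nearby[OF ge[OF order_refl]] by blast
    define m' where "m' = max 0 (m - \<sigma> / 2)"
    have m': "0 \<le> m'" "m' < m" "m - m' < \<sigma>" using \<sigma>(1) \<open>m > 0\<close> by (auto simp: m'_def)
    have "m' \<in> S" unfolding S_def
    proof (intro CollectI conjI allI impI)
      fix \<sigma>' assume "m' \<le> \<sigma>'"
      then show "ordered \<sigma>'" using \<sigma>(2)[of \<sigma>'] ge[of \<sigma>'] m' by (cases "\<sigma>' < m") auto
    qed (rule m')
    then have "m \<le> m'" unfolding m_def using S(2) by (intro cInf_lower)
    with m' show False by simp
  qed
  then show ?thesis using ge assms by simp
qed

lemma strictly_increasing_below:
  assumes "0 < \<tau>" and "u p < \<theta>"
  shows "u p < u (shift \<tau> p)"
proof -
  have "ordered \<tau>" using assms(1) by (intro ordered_nonneg) simp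
  then obtain \<eta> where "0 < \<eta>" "u p + \<eta> \<le> u (shift \<tau> p)"
    using increase_bounded_below[OF _ assms(1) range(1)[of p]] assms(2) by blast
  then show ?thesis by simp
qed

end

section \<open>The nonlinearity and the solution near its two limits\<close>

lemma time_derivative:
  assumes "C1_time u"
  shows "((\<lambda>s. u (x, s)) has_real_derivative time_partial u (x, t)) (at t)"
  using assms by (auto simp: C1_time_def time_partial_def DERIV_deriv_iff_field_differentiable)

lemma space_derivative:
  assumes "C1_space u"
  shows "((\<lambda>s. u (x + s *\<^sub>R axis i 1, t)) has_real_derivative space_partial i u (x + r *\<^sub>R axis i 1, t)) (at r)"
proof -
  have "((\<lambda>s. u (x + r *\<^sub>R axis i 1 + s *\<^sub>R axis i 1, t)) has_real_derivative
      space_partial i u (x + r *\<^sub>R axis i 1, t)) (at 0)"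
    using assms by (auto simp: C1_space_def space_partial_def DERIV_deriv_iff_field_differentiable)
  then have "((\<lambda>s. u (x + (s + r) *\<^sub>R axis i 1, t)) has_real_derivative
      space_partial i u (x + r *\<^sub>R axis i 1, t)) (at 0)"
    by (simp add: algebra_simps)
  then show ?thesis
    using DERIV_shift[of "\<lambda>s. u (x + s *\<^sub>R axis i 1, t)" _ 0 r] by simp
qed

lemma entire_solution_heat_op:
  assumes "entire_solution f u"
  shows "heat_op_at u p (f (u p))"
proof (cases p)
  case (Pair x t)
  have C: "C1_time u" "C1_space u" "\<And>i. C1_space (space_partial i u)"
    and eq: "time_partial u p - laplacian u p = f (u p)"
    using assms unfolding entire_solution_def by blast+
  show ?thesis unfolding Pair
  proof (rule heat_op_atI[OF time_derivative[OF C(1)] space_derivative[OF C(2)]])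
    show "((\<lambda>s. space_partial i u (x + s *\<^sub>R axis i 1, t)) has_real_derivative
        space_partial i (space_partial i u) (x, t)) (at 0)" for i
      using space_derivative[OF C(3)[of i], where r = 0 and i = i] by simp
    show "f (u (x, t)) = time_partial u (x, t) - (\<Sum>i\<in>UNIV. space_partial i (space_partial i u) (x, t))"
      using eq by (simp add: Pair laplacian_def)
  qed
qed

text \<open>
  The derivative of \<open>f\<close> is Hoelder continuous up to 0, so its negative value there persists on an
  interval.
\<close>

lemma bistable_antimono_near_0:
  assumes F1: "F1 f" and d: "d < 0" "(f has_real_derivative d) (at 0 within {0..1})"
  shows "\<exists>\<delta>>0. \<forall>r s. 0 < r \<longrightarrow> r \<le> s \<longrightarrow> s < \<delta> \<longrightarrow> f s \<le> f r"
proof -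
  obtain \<alpha> \<gamma> f' C where \<alpha>: "0 < \<alpha>" "\<alpha> < 1" and \<gamma>: "0 < \<gamma>" "\<gamma> < 1"
    and f': "\<And>s. s \<in> {0..<\<gamma>} \<union> {1 - \<gamma><..1} \<Longrightarrow>
        (f has_real_derivative f' s) (at s within {0..<\<gamma>} \<union> {1 - \<gamma><..1})"
    and C: "\<And>r s. r \<in> {0..<\<gamma>} \<union> {1 - \<gamma><..1} \<Longrightarrow> s \<in> {0..<\<gamma>} \<union> {1 - \<gamma><..1} \<Longrightarrow>
        \<bar>f' r - f' s\<bar> \<le> C * \<bar>r - s\<bar> powr \<alpha>"
    using F1 unfolding F1_def C1_Holder_on_def by (metis greaterThanLessThan_iff)
  \<comment> \<open>The two one-sided derivatives at 0 are taken within different sets; both are limits along [0, \<gamma>).\<close>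
  have "f' 0 = d"
  proof (rule tendsto_unique)
    have "\<not> trivial_limit (at (0::real) within {0<..<\<gamma>})"
      using \<gamma> by (simp add: trivial_limit_within islimpt_greaterThanLessThan1)
    moreover have "at (0::real) within {0<..<\<gamma>} \<le> at 0 within {0..<\<gamma>}" by (rule at_le) auto
    ultimately show "at (0::real) within {0..<\<gamma>} \<noteq> bot" by (metis bot.extremum_uniqueI)
    show "((\<lambda>y. (f y - f 0) / (y - 0)) \<longlongrightarrow> f' 0) (at 0 within {0..<\<gamma>})"
      using has_field_derivative_subset[OF f'[of 0], of "{0..<\<gamma>}"] \<gamma>
      unfolding has_field_derivative_iff by auto
    show "((\<lambda>y. (f y - f 0) / (y - 0)) \<longlongrightarrow> d) (at 0 within {0..<\<gamma>})"
      using has_field_derivative_subset[OF d(2), of "{0..<\<gamma>}"] \<gamma>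
      unfolding has_field_derivative_iff by fastforce
  qed
  define C' where "C' = max C 1"
  have C': "C' > 0" by (simp add: C'_def)
  define m where "m = - d / C'"
  have m: "m > 0" unfolding m_def using d(1) C' by (intro divide_pos_pos) auto
  \<comment> \<open>Below this bound the Hoelder oscillation C' s^\<alpha> is at most -d.\<close>
  define \<delta> where "\<delta> = min \<gamma> (m powr (1 / \<alpha>))"
  have \<delta>: "\<delta> > 0" using \<gamma>(1) m by (simp add: \<delta>_def)
  have neg: "f' s \<le> 0" if s: "0 < s" "s < \<delta>" for s
  proof -
    have "s powr \<alpha> \<le> (m powr (1 / \<alpha>)) powr \<alpha>"
      using s \<alpha> by (intro powr_mono2) (auto simp: \<delta>_def)
    also have "\<dots> = m" using \<alpha> m by (simp add: powr_powr)
    finally have "C' * s powr \<alpha> \<le> - d"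
      using mult_left_mono[of "s powr \<alpha>" m C'] C' by (simp add: m_def)
    moreover have "\<bar>f' s - f' 0\<bar> \<le> C * s powr \<alpha>"
      using C[of s 0] s \<gamma> by (simp add: \<delta>_def)
    moreover have "C * s powr \<alpha> \<le> C' * s powr \<alpha>" by (intro mult_right_mono) (auto simp: C'_def)
    ultimately show ?thesis using \<open>f' 0 = d\<close> by linarith
  qed
  have "f s \<le> f r" if rs: "0 < r" "r \<le> s" "s < \<delta>" for r s
  proof (rule DERIV_nonpos_imp_nonincreasing[OF rs(2)])
    fix y assume y: "r \<le> y" "y \<le> s"
    then have "y \<in> {0<..<\<gamma>}" using rs by (auto simp: \<delta>_def)
    then have "(f has_real_derivative f' y) (at y)"
      using has_field_derivative_subset[OF f'[of y], of "{0<..<\<gamma>}"]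
        at_within_open[of y "{0<..<\<gamma>}"] by fastforce
    moreover have "f' y \<le> 0" using neg[of y] rs y by linarith
    ultimately show "\<exists>d. (f has_real_derivative d) (at y) \<and> d \<le> 0" by blast
  qed
  then show ?thesis using \<delta> by blast
qed

lemma F4_antimono_near_0:
  assumes "F1 f" and "F4 f"
  shows "\<exists>\<delta>>0. \<forall>r s. 0 < r \<longrightarrow> r \<le> s \<longrightarrow> s < \<delta> \<longrightarrow> f s \<le> f r"
proof -
  obtain \<theta> where \<theta>: "0 < \<theta>" "bistable \<theta> f \<or> combustion \<theta> f"
    using assms(2) unfolding F4_def by auto
  then consider d where "d < 0" "(f has_real_derivative d) (at 0 within {0..1})"
    | "\<forall>s\<in>{0<..<\<theta>}. f s = 0"
    unfolding bistable_def combustion_def by blast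
  then show ?thesis
  proof cases
    case 1 then show ?thesis using bistable_antimono_near_0[OF assms(1)] by blast
  next
    case 2 then show ?thesis using \<theta>(1) by (intro exI[of _ \<theta>]) auto
  qed
qed

text \<open>
  Off the graph \<open>u\<close> avoids the value \<open>\<theta>\<close>. A point below the graph with \<open>u > \<theta>\<close> is impossible,
  since \<open>u\<close> would keep increasing in time and exceed \<open>\<theta>\<close> on the graph. The region above the graph
  is connected and contains the given point with \<open>u > \<theta>\<close>.
\<close>

lemma superlevel_set_eq_epigraph:
  fixes u :: "(real^'n::finite) \<times> real \<Rightarrow> real"
  assumes cont: "continuous_on UNIV u" and C1: "C1_time u"
    and level: "{p. u p = \<theta>} = {(x, t). t = h x}" and h: "continuous_on UNIV h"
    and incr: "\<And>p. \<theta> < u p \<Longrightarrow> 0 < time_partial u p"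
    and ex: "\<theta> < u p0"
  shows "\<theta> \<le> u (x, t) \<longleftrightarrow> h x \<le> t"
proof -
  have lev: "u (x, t) = \<theta> \<longleftrightarrow> t = h x" for x t using level by (auto simp: set_eq_iff)
  have ct: "continuous_on A (\<lambda>s. u (x, s))" for A x
    by (intro continuous_on_compose2[OF cont] continuous_intros) auto
  obtain x0 t0 where p0: "p0 = (x0, t0)" by (cases p0)
  have below: "u (x, t) < \<theta>" if t: "t < h x" for x t
  proof (rule ccontr)
    assume "\<not> u (x, t) < \<theta>"
    then have gt: "\<theta> < u (x, t)" using lev[of x t] t by simp
    have gt': "\<theta> < u (x, s)" if s: "t \<le> s" "s < h x" for s
    proof (rule ccontr)
      assume "\<not> \<theta> < u (x, s)"
      then obtain r where "t \<le> r" "r \<le> s" "u (x, r) = \<theta>"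
        using IVT2'[of "\<lambda>s. u (x, s)" s \<theta> t] gt s ct by force
      then show False using lev s by simp
    qed
    have "u (x, t) < u (x, h x)"
    proof (rule DERIV_pos_imp_increasing_open[OF t])
      show "\<exists>y. ((\<lambda>s. u (x, s)) has_real_derivative y) (at s) \<and> 0 < y" if "t < s" "s < h x" for s
        using time_derivative[OF C1] incr[OF gt'] that by (meson less_imp_le)
    qed (rule ct)
    with gt lev[of x "h x"] show False by simp
  qed
  have "h x0 < t0"
    using below[of t0 x0] lev[of x0 t0] ex by (cases t0 "h x0" rule: linorder_cases) (auto simp: p0)
  have aboveg: "\<theta> < u (x, t)" if t: "h x < t" for x t
  proof (rule ccontr)
    assume "\<not> \<theta> < u (x, t)"
    then have lt: "u (x, t) < \<theta>" using lev[of x t] t by simp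
    define a where "a = t - h x"
    define b where "b = t0 - h x0"
    \<comment> \<open>A path above the graph from the given point to (x, t), interpolating the heights a and b.\<close>
    define c where "c s = (x0 + s *\<^sub>R (x - x0), h (x0 + s *\<^sub>R (x - x0)) + (b + s * (a - b)))" for s :: real
    have ab: "a > 0" "b > 0" using t \<open>h x0 < t0\<close> by (auto simp: a_def b_def)
    have "continuous_on {0..1} (\<lambda>s. u (c s))" unfolding c_def
      by (intro continuous_on_compose2[OF cont] continuous_on_compose2[OF h] continuous_intros) auto
    moreover have "u (c 0) > \<theta>" using ex by (simp add: c_def b_def p0)
    moreover have "u (c 1) < \<theta>" using lt by (simp add: c_def a_def)
    ultimately obtain s where s: "0 \<le> s" "s \<le> 1" "u (c s) = \<theta>"
      using IVT2'[of "\<lambda>s. u (c s)" 1 \<theta> 0] by force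
    then have "b + s * (a - b) = 0" using lev by (simp add: c_def)
    moreover have "b + s * (a - b) = (1 - s) * b + s * a" by (simp add: algebra_simps)
    moreover have "(1 - s) * b + s * a > 0"
      using s ab by (cases "s = 0") (auto intro!: add_nonneg_pos)
    ultimately show False by simp
  qed
  show ?thesis using below[of t x] aboveg[of x t] lev[of x t]
    by (cases t "h x" rule: linorder_cases) auto
qed

text \<open>
  The two bounds say that $-\ln(1-u)$ has time derivative at least \<open>c\<close> and space derivatives at most
  \<open>C\<close> above the graph. Moving first up in time by \<open>\<tau>\<close> gains \<open>c * \<tau>\<close> and lifts the point so high that
  the subsequent horizontal staircase, which loses at most \<open>C\<close> per unit length, stays above the
  graph. The cone is narrow enough for the gain to cover the loss; the summand 1 in its slope keeps
  the staircase strictly above the graph, where the bounds hold.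
\<close>

lemma cone_monotone_above:
  fixes u :: "(real^'n::finite) \<times> real \<Rightarrow> real"
  assumes cont: "continuous_on UNIV u" and C1: "C1_time u" "C1_space u"
    and lt1: "\<And>p. u p < 1"
    and h_lip: "L-lipschitz_on UNIV h"
    and above: "\<And>x t. h x < t \<Longrightarrow> \<theta> < u (x, t)"
    and c: "0 < c" and C: "0 \<le> C"
    and time: "\<And>p. \<theta> < u p \<Longrightarrow> c * (1 - u p) \<le> time_partial u p"
    and space: "\<And>p i. \<theta> < u p \<Longrightarrow> \<bar>space_partial i u p\<bar> \<le> C * (1 - u p)"
    and x: "h x \<le> t" and \<tau>: "(real CARD('n) * (L + C / c) + 1) * norm \<zeta> \<le> \<tau>"
  shows "u (x, t) \<le> u (x + \<zeta>, t + \<tau>)"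
proof -
  let ?N = "real CARD('n)"
  define G where "G p = - ln (1 - u p)" for p
  have L: "0 \<le> L" by (rule lipschitz_on_nonneg[OF h_lip])
  have pos: "0 < 1 - u p" for p using lt1[of p] by simp
  have Cc: "0 \<le> C / c" using C c by simp
  have eq: "(?N * (L + C / c) + 1) * norm \<zeta> = L * (?N * norm \<zeta>) + ?N * (C / c) * norm \<zeta> + norm \<zeta>"
    by (simp add: algebra_simps)
  have nn: "0 \<le> L * (?N * norm \<zeta>)" "0 \<le> ?N * (C / c) * norm \<zeta>"
    using L Cc by (auto intro!: mult_nonneg_nonneg simp del: times_divide_eq_right)
  show ?thesis
  proof (cases "\<tau> = 0")
    case True
    then have "norm \<zeta> \<le> 0" using \<tau> nn unfolding eq by linarith
    then show ?thesis using True by simp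
  next
    case False
    then have \<tau>0: "0 < \<tau>" using \<tau> nn norm_ge_zero[of \<zeta>] unfolding eq by linarith
    \<comment> \<open>The staircase stays above the graph.\<close>
    have wide: "L * (?N * norm \<zeta>) < \<tau>"
    proof (cases "\<zeta> = 0")
      case False
      then have "0 < norm \<zeta>" by simp
      then show ?thesis using \<tau> nn unfolding eq by linarith
    qed (simp add: \<tau>0)
    \<comment> \<open>The gain in time covers the loss in space.\<close>
    have fast: "C * ?N * norm \<zeta> \<le> c * \<tau>"
    proof -
      have "?N * (C / c) * norm \<zeta> \<le> \<tau>" using \<tau> nn norm_ge_zero[of \<zeta>] unfolding eq by linarith
      then have "c * (?N * (C / c) * norm \<zeta>) \<le> c * \<tau>" using c by (intro mult_left_mono) auto
      then show ?thesis using c by (simp add: mult_ac)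
    qed
    have "G (x, t) - c * t \<le> G (x, t + \<tau>) - c * (t + \<tau>)"
    proof (rule DERIV_nonneg_imp_increasing_open[where f = "\<lambda>s. G (x, s) - c * s"])
      fix s assume s: "t < s" "s < t + \<tau>"
      have "((\<lambda>s. 1 - u (x, s)) has_real_derivative 0 - time_partial u (x, s)) (at s)"
        by (intro DERIV_diff DERIV_const time_derivative C1)
      from DERIV_diff[OF DERIV_minus[OF DERIV_chain2[OF DERIV_ln[OF pos] this]] DERIV_cmult_Id[of c]]
      have "((\<lambda>s. G (x, s) - c * s) has_real_derivative
          time_partial u (x, s) / (1 - u (x, s)) - c) (at s)"
        unfolding G_def by (simp add: divide_inverse mult.commute)
      moreover have "0 \<le> time_partial u (x, s) / (1 - u (x, s)) - c"
        using time[OF above, of x s] s x pos[of "(x, s)"] by (simp add: le_divide_eq)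
      ultimately show "\<exists>y. ((\<lambda>s. G (x, s) - c * s) has_real_derivative y) (at s) \<and> 0 \<le> y"
        by blast
    next
      show "continuous_on {t..t + \<tau>} (\<lambda>s. G (x, s) - c * s)"
        unfolding G_def using pos
        by (intro continuous_intros continuous_on_compose2[OF cont]) (auto simp: less_imp_neq[OF lt1])
    qed (use \<tau>0 in auto)
    moreover have "- G (x + \<zeta>, t + \<tau>) - - G (x, t + \<tau>) \<le> C * ?N * norm \<zeta>"
    proof (rule lipschitz_of_coordinate_steps[OF C, where F = "\<lambda>y. - G (y, t + \<tau>)"])
      fix y i assume y: "norm (y - x) \<le> ?N * norm \<zeta>"
        "norm (y + (\<zeta> $ i) *\<^sub>R axis i 1 - x) \<le> ?N * norm \<zeta>"
      have "norm (- G (y + (\<zeta> $ i) *\<^sub>R axis i 1, t + \<tau>) - - G (y + 0 *\<^sub>R axis i 1, t + \<tau>))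
          \<le> C * norm (\<zeta> $ i - 0)"
      proof (rule field_differentiable_bound[where S = "closed_segment 0 (\<zeta> $ i)"
            and f = "\<lambda>s. - G (y + s *\<^sub>R axis i 1, t + \<tau>)"])
        fix s assume s: "s \<in> closed_segment 0 (\<zeta> $ i)"
        define p where "p = (y + s *\<^sub>R axis i 1, t + \<tau>)"
        obtain v where v: "0 \<le> v" "v \<le> 1" "s = v * (\<zeta> $ i)"
          using s by (auto simp: in_segment)
        have "y + s *\<^sub>R axis i 1 - x = (1 - v) *\<^sub>R (y - x) + v *\<^sub>R (y + (\<zeta> $ i) *\<^sub>R axis i 1 - x)"
          by (simp add: v algebra_simps)
        also have "norm \<dots> \<le> (1 - v) * norm (y - x) + v * norm (y + (\<zeta> $ i) *\<^sub>R axis i 1 - x)"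
          using v by (intro order_trans[OF norm_triangle_ineq]) simp
        also have "\<dots> \<le> ?N * norm \<zeta>" using v y by (intro convex_bound_le) auto
        finally have "L * norm (y + s *\<^sub>R axis i 1 - x) \<le> L * (?N * norm \<zeta>)"
          using L by (intro mult_left_mono)
        moreover have "h (y + s *\<^sub>R axis i 1) \<le> h x + L * norm (y + s *\<^sub>R axis i 1 - x)"
          using lipschitz_onD[OF h_lip, of "y + s *\<^sub>R axis i 1" x] by (auto simp: dist_norm abs_le_iff)
        ultimately have "\<theta> < u p" unfolding p_def using wide x by (intro above) linarith
        then have "norm (space_partial i u p / (1 - u p)) \<le> C"
          using space[of p i] pos[of p] by (simp add: abs_divide divide_le_eq)
        then show "norm (- (space_partial i u (y + s *\<^sub>R axis i 1, t + \<tau>) /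
            (1 - u (y + s *\<^sub>R axis i 1, t + \<tau>)))) \<le> C"
          by (simp only: p_def norm_minus_cancel)
        have "((\<lambda>s. 1 - u (y + s *\<^sub>R axis i 1, t + \<tau>)) has_real_derivative 0 - space_partial i u p) (at s)"
          unfolding p_def by (intro DERIV_diff DERIV_const space_derivative C1)
        from DERIV_minus[OF DERIV_minus[OF DERIV_chain2[OF DERIV_ln[OF pos] this]]]
        have "((\<lambda>s. - G (y + s *\<^sub>R axis i 1, t + \<tau>)) has_real_derivative
            - (space_partial i u p / (1 - u p))) (at s)"
          unfolding G_def by (simp add: divide_inverse mult.commute p_def)
        then show "((\<lambda>s. - G (y + s *\<^sub>R axis i 1, t + \<tau>)) has_real_derivative
            - (space_partial i u (y + s *\<^sub>R axis i 1, t + \<tau>) / (1 - u (y + s *\<^sub>R axis i 1, t + \<tau>))))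
            (at s within closed_segment 0 (\<zeta> $ i))"
          unfolding p_def by (rule has_field_derivative_at_within)
      qed auto
      then show "- G (y + (\<zeta> $ i) *\<^sub>R axis i 1, t + \<tau>) - - G (y, t + \<tau>) \<le> C * \<bar>\<zeta> $ i\<bar>"
        by simp
    qed
    ultimately have "G (x, t) \<le> G (x + \<zeta>, t + \<tau>)" using fast by (simp add: algebra_simps)
    then show ?thesis using pos by (simp add: G_def)
  qed
qed

text \<open>
  Below a Lipschitz graph the vertical depth is at most \<open>1 + L\<close> times the distance to the epigraph.
\<close>

lemma H2_decay_below_graph:
  fixes u :: "(real^'n::finite) \<times> real \<Rightarrow> real"
  assumes "H2 b u" and pos: "\<And>p. 0 < u p" and front: "\<And>x t. 1 - b \<le> u (x, t) \<longleftrightarrow> h x \<le> t"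
    and h_lip: "L-lipschitz_on UNIV h" and \<epsilon>: "0 < \<epsilon>"
  shows "\<exists>R. \<forall>x t. R \<le> h x - t \<longrightarrow> u (x, t) < \<epsilon>"
proof -
  obtain R where R: "\<And>p. R \<le> infdist p {q. 1 - b \<le> u q} \<Longrightarrow> \<bar>u p\<bar> < \<epsilon>"
    using assms(1) \<epsilon> unfolding H2_def by blast
  have L: "0 \<le> L" by (rule lipschitz_on_nonneg[OF h_lip])
  have "u (x, t) < \<epsilon>" if xt: "R * (1 + L) \<le> h x - t" for x t
  proof -
    have "R \<le> dist (x, t) q" if q: "1 - b \<le> u q" for q
    proof -
      obtain y s where ys: "q = (y, s)" by (cases q)
      have "h y \<le> s" using q front by (simp add: ys)
      moreover have "h x - h y \<le> L * dist x y" 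
        using lipschitz_onD[OF h_lip, of x y] by (auto simp: dist_real_def abs_le_iff)
      moreover have "L * dist x y \<le> L * dist (x, t) q"
        using L dist_fst_le[of "(x, t)" q] by (intro mult_left_mono) (auto simp: ys)
      moreover have "s - t \<le> dist (x, t) q"
        using dist_snd_le[of "(x, t)" q] by (simp add: ys dist_real_def abs_le_iff)
      ultimately have "R * (1 + L) \<le> dist (x, t) q * (1 + L)" using xt by (simp add: algebra_simps)
      then show ?thesis using L by simp
    qed
    moreover have "(x, h x) \<in> {q. 1 - b \<le> u q}" using front by simp
    ultimately have "R \<le> infdist (x, t) {q. 1 - b \<le> u q}"
      unfolding infdist_def by (auto intro!: cINF_greatest)
    then show ?thesis using R[of "(x, t)"] pos by fastforce
  qed
  then show ?thesis by blast
qed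

section \<open>The level sets\<close>

text \<open>
  The levels from \<open>1 - b0\<close> on are graphs by the choice of \<open>b0\<close>. For a lower level, \<open>u\<close> increases
  strictly below the front along every direction of the cone \<open>K * norm \<zeta> \<le> \<tau>\<close>. The vertical
  direction makes the level set a graph; the other directions bound its slope by \<open>K\<close>.
\<close>

theorem theorem1p2:
  fixes f :: "real \<Rightarrow> real"
    and b0 :: real
    and u :: "(real^'n::finite) \<times> real \<Rightarrow> real"
  assumes "F1 f" and "F2 f" and "F3 f" and "F4 f"
    and "front_constant TYPE('n) f b0"
    and "entire_solution f u"
    and "\<forall>p. 0 < u p \<and> u p < 1"
    and "H1 u"
    and "H2 b0 u"
  shows "\<forall>l\<in>{0<..<1}. \<exists>h :: real^'n \<Rightarrow> real.
    (\<exists>L. L-lipschitz_on UNIV h) \<and> {p. u p = l} = {(x, t). t = h x}"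
proof
  fix l :: real assume l: "l \<in> {0<..<1}"
  define \<theta> where "\<theta> = 1 - b0"
  from assms(5) obtain c C where b0: "0 < b0" "b0 < 1" and cC: "0 < c" "0 < C"
    and fc: "\<And>w :: (real^'n) \<times> real \<Rightarrow> real.
        entire_solution f w \<and> (\<forall>p. 0 < w p \<and> w p < 1) \<and> H1 w \<Longrightarrow>
        (\<forall>l\<in>{1 - b0..<1}. level_set_Lipschitz_graph w l) \<and>
        (\<forall>p. w p > 1 - b0 \<longrightarrow>
          time_partial w p \<ge> c * (1 - w p) \<and>
          norm (gradient w p) + \<bar>time_partial w p\<bar> \<le> C * (1 - w p))"
    unfolding front_constant_def by metis
  have upper: "\<And>l. l \<in> {\<theta>..<1} \<Longrightarrow> level_set_Lipschitz_graph u l"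
    and time: "\<And>p. \<theta> < u p \<Longrightarrow> c * (1 - u p) \<le> time_partial u p"
    and grad: "\<And>p. \<theta> < u p \<Longrightarrow> norm (gradient u p) + \<bar>time_partial u p\<bar> \<le> C * (1 - u p)"
    using fc[of u] assms(6-8) unfolding \<theta>_def by blast+
  have range: "\<And>p. 0 < u p" "\<And>p. u p < 1" using assms(7) by blast+
  have cont: "continuous_on UNIV u" and C1: "C1_time u" "C1_space u"
    using assms(6) unfolding entire_solution_def by blast+
  show "\<exists>h :: real^'n \<Rightarrow> real. (\<exists>L. L-lipschitz_on UNIV h) \<and> {p. u p = l} = {(x, t). t = h x}"
  proof (cases "\<theta> \<le> l")
    case True
    then show ?thesis using upper[of l] l unfolding level_set_Lipschitz_graph_def by auto
  next
    case False
    then have l\<theta>: "0 < l" "l < \<theta>" using l by auto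
    obtain h L where h_lip: "L-lipschitz_on UNIV h" and level: "{p. u p = \<theta>} = {(x, t). t = h x}"
      using upper[of \<theta>] b0 unfolding level_set_Lipschitz_graph_def \<theta>_def by auto
    have "\<theta> < (SUP x. u (x, 0))" using assms(8) b0 by (simp add: H1_def \<theta>_def)
    moreover have "bdd_above (range (\<lambda>x. u (x, 0)))"
      using range(2) by (auto intro!: bdd_aboveI[of _ 1] less_imp_le)
    ultimately obtain x0 where x0: "\<theta> < u (x0, 0)"
      using less_cSUP_iff[of UNIV "\<lambda>x. u (x, 0)" \<theta>] by auto
    have front: "\<theta> \<le> u (x, t) \<longleftrightarrow> h x \<le> t" for x t
    proof (rule superlevel_set_eq_epigraph[OF cont C1(1) level _ _ x0])
      show "continuous_on UNIV h" by (rule lipschitz_on_continuous_on[OF h_lip])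
      show "0 < time_partial u p" if "\<theta> < u p" for p
        using time[OF that] cC(1) range(2)[of p] mult_pos_pos[of c "1 - u p"] by linarith
    qed
    have above: "\<theta> < u (x, t)" if "h x < t" for x t
    proof -
      have "u (x, t) \<noteq> \<theta>" using level that by (auto simp: set_eq_iff)
      then show ?thesis using front[of x t] that by simp
    qed
    have space: "\<bar>space_partial i u p\<bar> \<le> C * (1 - u p)" if "\<theta> < u p" for p i
      using grad[OF that] component_le_norm_cart[of "gradient u p" i] by (simp add: gradient_def)
    define K where "K = real CARD('n) * (L + C / c) + 1"
    have L: "0 \<le> L" by (rule lipschitz_on_nonneg[OF h_lip])
    have KL: "L < K"
    proof -
      have "1 * L \<le> real CARD('n) * L" using L by (intro mult_right_mono) (auto simp: Suc_le_eq)
      moreover have "0 \<le> real CARD('n) * (C / c)" using cC by auto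
      moreover have "K = real CARD('n) * L + real CARD('n) * (C / c) + 1"
        by (simp add: K_def algebra_simps)
      ultimately show ?thesis by linarith
    qed
    then have K: "0 < K" using L by simp
    obtain \<delta> where \<delta>: "0 < \<delta>" "\<And>r s. 0 < r \<Longrightarrow> r \<le> s \<Longrightarrow> s < \<delta> \<Longrightarrow> f s \<le> f r"
      using F4_antimono_near_0[OF assms(1,4)] by blast
    obtain \<Lambda> where \<Lambda>: "\<Lambda>-lipschitz_on {0..1} f" using assms(1) unfolding F1_def by blast
    have decay: "\<exists>R. \<forall>x t. R \<le> h x - t \<longrightarrow> u (x, t) < \<epsilon>" if "0 < \<epsilon>" for \<epsilon>
      by (rule H2_decay_below_graph[OF assms(9) range(1) front[unfolded \<theta>_def] h_lip that])
    \<comment> \<open>The sliding argument applies in the direction \<zeta> / \<tau> with time shift \<tau>.\<close>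
    have increasing: "u (x, t) < u (x + \<zeta>, t + \<tau>)"
      if "0 < \<tau>" "K * norm \<zeta> \<le> \<tau>" "u (x, t) < \<theta>" for x t \<zeta> \<tau>
    proof -
      define \<xi> where "\<xi> = (1 / \<tau>) *\<^sub>R \<zeta>"
      have \<xi>: "K * norm \<xi> \<le> 1" using that by (simp add: \<xi>_def divide_le_eq)
      interpret sliding_front f u h \<xi> \<Lambda> L \<theta> \<delta>
      proof
        show "L * norm \<xi> < 1"
        proof (cases "\<xi> = 0")
          case False
          then have "L * norm \<xi> < K * norm \<xi>" using KL by simp
          with \<xi> show ?thesis by linarith
        qed simp
        show "u (x, t) \<le> u (x + \<sigma> *\<^sub>R \<xi>, t + \<sigma>)" if "h x \<le> t" "0 \<le> \<sigma>" for x t \<sigma>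
        proof (rule cone_monotone_above[OF cont C1 range(2) h_lip above cC(1) less_imp_le[OF cC(2)]
              time space that(1)])
          have "\<sigma> * (K * norm \<xi>) \<le> \<sigma> * 1" using \<xi> that(2) by (intro mult_left_mono)
          then show "(real CARD('n) * (L + C / c) + 1) * norm (\<sigma> *\<^sub>R \<xi>) \<le> \<sigma>"
            using that(2) unfolding K_def[symmetric] by (simp add: mult_ac)
        qed
      qed (fact entire_solution_heat_op[OF assms(6)] cont range \<Lambda> \<delta> front h_lip decay)+
      show ?thesis
        using strictly_increasing_below[OF that(1,3)] that(1)
        unfolding shift_Pair by (simp add: \<xi>_def)
    qed
    obtain R where R: "\<And>x t. R \<le> h x - t \<Longrightarrow> u (x, t) < l" using decay[OF l\<theta>(1)] by blast
    \<comment> \<open>Along each vertical line u runs from below l far below the front to at least \<theta> > l on it.\<close>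
    have "\<exists>t. u (x, t) = l" for x
    proof -
      have "u (x, h x - \<bar>R\<bar>) < l" by (rule R) simp
      moreover have "l \<le> u (x, h x)" using front[of x "h x"] l\<theta> by simp
      moreover have "continuous_on {h x - \<bar>R\<bar>..h x} (\<lambda>s. u (x, s))"
        by (intro continuous_on_compose2[OF cont] continuous_intros) auto
      ultimately show ?thesis
        using IVT'[of "\<lambda>s. u (x, s)" "h x - \<bar>R\<bar>" l "h x"] by force
    qed
    then obtain k where k: "\<And>x. u (x, k x) = l" by metis
    have uniq: "t = k x" if "u (x, t) = l" for x t
    proof (rule ccontr)
      assume "t \<noteq> k x"
      then show False
        using increasing[of "k x - t" 0 x t] increasing[of "t - k x" 0 x "k x"] that k[of x] l\<theta>
        by (cases "t < k x") auto
    qed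
    have "k y - k x \<le> K * norm (y - x)" for x y
    proof (rule ccontr)
      assume *: "\<not> ?thesis"
      have "0 \<le> K * norm (y - x)" using K by simp
      with * have "u (x, k x) < u (x + (y - x), k x + (k y - k x))"
        using k[of x] l\<theta> by (intro increasing) auto
      then show False using k by simp
    qed
    then have "\<bar>k x - k y\<bar> \<le> K * norm (x - y)" for x y
      by (metis abs_le_iff minus_diff_eq norm_minus_commute)
    then have "K-lipschitz_on UNIV k"
      using K by (intro lipschitz_onI) (auto simp: dist_norm)
    moreover have "{p. u p = l} = {(x, t). t = k x}" using k uniq by auto
    ultimately show ?thesis by blast
  qed
qed

end
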